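(* Consider a rank-$K$ maxout network, $K\ge 2$, with $n_0$ inputs, $n_1$ units in the first layer, and any number of additional layers of nonzero width. Then for almost every choice of the parameters (with respect to Lebesgue measure), the represented function has at least $\sum_{j=0}^{n_0}\binom{n_1}{j}$ linear regions, and at least $\binom{n_1-1}{n_0}$ bounded linear regions.
   Context: A rank-$K$ maxout unit with $n$ inputs computes $y\mapsto\max_{k\in[K]}\{w_k\cdot y+b_k\}$ with trainable $w_k\in\mathbb{R}^n$, $b_k\in\mathbb{R}$. A fully connected feedforward maxout network with $n_0$ inputs composes layers $\phi_l:\mathbb{R}^{n_{l-1}}\to\mathbb{R}^{n_l}$ whose coordinates are rank-$K$ maxout units, followed by a linear output layer. A linear region of a piecewise linear function on $\mathbb{R}^{n_0}$ is a maximal connected subset of $\mathbb{R}^{n_0}$ on which the function has constant gradient. *)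

theory Defs
  imports "HOL-Analysis.Analysis"
begin

definition ix :: "'a::finite \<Rightarrow> nat" where
  "ix = (SOME g. bij_betw g (UNIV::'a set) {..<CARD('a)})"

definition width :: "nat \<Rightarrow> nat list \<Rightarrow> nat \<Rightarrow> nat" where
  "width n0 ns l = (if l = 0 then n0 else ns ! (l - 1))"

text \<open>Parameter index set.  An index (l,i,k,j) with 1 \<le> l \<le> L is the j-th weight
  (j < width of layer l-1) or the bias (j = width of layer l-1) of the k-th affine
  piece of unit i in maxout layer l.  Indices (L+1,o,0,j) are the weights / bias of
  output coordinate o of the linear output layer (m outputs).\<close>
definition maxout_params :: "nat \<Rightarrow> nat list \<Rightarrow> nat \<Rightarrow> nat \<Rightarrow> (nat \<times> nat \<times> nat \<times> nat) set" where
  "maxout_params n0 ns K m =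
     {(l,i,k,j). (1 \<le> l \<and> l \<le> length ns \<and> i < width n0 ns l \<and> k < K \<and> j \<le> width n0 ns (l - 1))
               \<or> (l = Suc (length ns) \<and> i < m \<and> k = 0 \<and> j \<le> width n0 ns (length ns))}"

definition maxout_unit ::
  "(nat \<times> nat \<times> nat \<times> nat \<Rightarrow> real) \<Rightarrow> nat \<Rightarrow> nat \<Rightarrow> nat \<Rightarrow> nat \<Rightarrow> (nat \<Rightarrow> real) \<Rightarrow> real" where
  "maxout_unit \<theta> K d l i h = Max ((\<lambda>k. (\<Sum>j<d. \<theta> (l,i,k,j) * h j) + \<theta> (l,i,k,d)) ` {..<K})"

fun maxout_hidden ::
  "(nat \<times> nat \<times> nat \<times> nat \<Rightarrow> real) \<Rightarrow> nat \<Rightarrow> nat list \<Rightarrow> nat \<Rightarrow> nat \<Rightarrow> (nat \<Rightarrow> real) \<Rightarrow> (nat \<Rightarrow> real)" where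
  "maxout_hidden \<theta> n0 ns K 0 x = x"
| "maxout_hidden \<theta> n0 ns K (Suc l) x =
     (\<lambda>i. maxout_unit \<theta> K (width n0 ns l) (Suc l) i (maxout_hidden \<theta> n0 ns K l x))"

definition maxout_net ::
  "(nat \<times> nat \<times> nat \<times> nat \<Rightarrow> real) \<Rightarrow> nat list \<Rightarrow> nat \<Rightarrow> real^'n \<Rightarrow> real^'m" where
  "maxout_net \<theta> ns K x =
     (\<chi> r. let L = length ns; n0 = CARD('n);
               h = maxout_hidden \<theta> n0 ns K L
                     (\<lambda>j. if j < n0 then x $ (inv_into UNIV (ix :: 'n \<Rightarrow> nat) j) else 0)
           in (\<Sum>j<width n0 ns L. \<theta> (Suc L, ix r, 0, j) * h j) + \<theta> (Suc L, ix r, 0, width n0 ns L))"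

definition linear_regions ::
  "('a::real_normed_vector \<Rightarrow> 'b::real_normed_vector) \<Rightarrow> 'a set set" where
  "linear_regions f = (\<Union>D. components {x. (f has_derivative D) (at x)})"

end

theory Submission
  imports Defs
begin

text \<open>
  Counting only cells of the first layer suffices: on a cell the network selects one affine piece per
  unit, and for almost every parameter distinct selections have distinct gradients, because the
  difference of two gradients is a nonzero polynomial in the parameters. Hence cells with different
  first-layer patterns lie in different linear regions, and a linear region stays inside the closed
  first-layer cell of its pattern.

  For first-layer units in general position, any at most \<open>n0\<close> units are simultaneously tied at
  some point. Units are added one at a time: among the points where the earlier units are tied,
  minimise the gap between the active piece and another piece of the new unit; if the new unit were
  not tied at the minimiser, general position would yield a direction that keeps the earlier ties and
  decreases the gap. Near a point where the units in \<open>J\<close> are tied, the patterns contain a full cube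
  with directions \<open>J\<close>, and a family has at least as many members as there are index sets of cubes
  in it; this gives the sum of binomial coefficients. For bounded cells, each point at which \<open>n0\<close>
  units other than the first are tied is the apex of one bounded cell.
\<close>

subsection \<open>Cubes in families of functions\<close>

text \<open>The tie set of a unit with more than two pieces is a bent polyhedral complex: two pieces
  may agree at a point where a third one is larger. Intersecting hyperplanes therefore does not
  produce a common tie of several units, and a minimisation that respects the maxima takes its
  place. Its delicate case is that of fewer than \<open>n0\<close> earlier units which already carry
  \<open>n0\<close> tie equations. Then no equation is left free, but some unit has three active
  pieces, and any one of them can be given up. The cube count is a many-valued form of Pajor's
  strengthening of the Sauer-Shelah lemma. It turns local information at crossing points into a
  global count, without a recursion over subarrangements. Every general position property is
  obtained from one fact: a polynomial that is nonzero somewhere is nonzero almost everywhere. Each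
  property thus costs one explicit parameter. Linear regions are components of sets with a
  prescribed derivative, and the derivative may exist on the boundary of cells; hence gradients also
  have to be identified at boundary points.\<close>

definition has_cube :: "('i \<Rightarrow> 'v) set \<Rightarrow> 'i set \<Rightarrow> bool" where
  "has_cube F J \<longleftrightarrow> (\<exists>p q. (\<forall>i\<in>J. p i \<noteq> q i) \<and> (\<forall>A\<subseteq>J. (\<lambda>i. if i \<in> A then q i else p i) \<in> F))"

text \<open>A cube through the coordinate \<open>a\<close> restricts to cubes in two different slices
  \<open>{f \<in> F. f a = v}\<close>, a cube not using \<open>a\<close> lies in one slice; so the cubes of \<open>F\<close> inject into the
  disjoint union of the cubes of the slices.\<close>

lemma card_cubes_le:
  assumes "finite I" "finite F"
  shows "card {J. J \<subseteq> I \<and> has_cube F J} \<le> card F"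
  using assms
proof (induction I arbitrary: F rule: finite_induct)
  case empty
  show ?case
  proof (cases "F = {}")
    case True
    then have "\<not> has_cube F J" for J by (auto simp: has_cube_def)
    then show ?thesis by simp
  next
    case False
    have "card {J. J \<subseteq> {} \<and> has_cube F J} \<le> card {{} :: 'a set}"
      by (rule card_mono) auto
    also have "\<dots> \<le> card F"
      using False empty by (simp add: Suc_leI card_gt_0_iff)
    finally show ?thesis .
  qed
next
  case (insert a I)
  define G where "G v = {f \<in> F. f a = v}" for v
  define C where "C v = {J. J \<subseteq> I \<and> has_cube (G v) J}" for v
  define V where "V = (\<lambda>f. f a) ` F"
  define fst_v where "fst_v J = (SOME v. v \<in> V \<and> J \<in> C v)" for J
  define snd_v where "snd_v J = (SOME v. v \<in> V \<and> J \<in> C v \<and> v \<noteq> fst_v J)" for J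
  \<comment> \<open>A set containing \<open>a\<close> and the same set without \<open>a\<close> may
    both carry cubes. Sending them to two different slices keeps \<open>h\<close> injective.\<close>
  define h where "h J = (if a \<in> J then (snd_v (J - {a}), J - {a}) else (fst_v J, J))" for J
  have inV: "v \<in> V" if "J \<in> C v" for v J
    using that by (auto simp: C_def has_cube_def G_def V_def image_iff)
  have fst_prop: "fst_v J \<in> V \<and> J \<in> C (fst_v J)" if "J \<in> C v" for v J
    unfolding fst_v_def using that inV by (intro someI[of "\<lambda>v. v \<in> V \<and> J \<in> C v" v]) auto
  have snd_prop: "snd_v J \<in> V \<and> J \<in> C (snd_v J) \<and> snd_v J \<noteq> fst_v J"
    if J: "J \<in> C v" "J \<in> C v'" "v \<noteq> v'" for v v' J
  proof -
    obtain u where "u \<in> V \<and> J \<in> C u \<and> u \<noteq> fst_v J" using J inV by metis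
    then show ?thesis unfolding snd_v_def
      by (rule someI[of "\<lambda>v. v \<in> V \<and> J \<in> C v \<and> v \<noteq> fst_v J"])
  qed
  have without_a: "\<exists>v. J \<in> C v" if J: "J \<subseteq> insert a I" "has_cube F J" "a \<notin> J" for J
  proof -
    obtain p q where pq: "\<forall>i\<in>J. p i \<noteq> q i" "\<forall>A\<subseteq>J. (\<lambda>i. if i \<in> A then q i else p i) \<in> F"
      using J(2) by (auto simp: has_cube_def)
    have "\<forall>A\<subseteq>J. (\<lambda>i. if i \<in> A then q i else p i) \<in> G (p a)"
      using pq(2) J(3) by (auto simp: G_def)
    then have "J \<in> C (p a)" using pq(1) J by (auto simp: C_def has_cube_def)
    then show ?thesis ..
  qed
  have with_a: "\<exists>v v'. v \<noteq> v' \<and> J - {a} \<in> C v \<and> J - {a} \<in> C v'"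
    if J: "J \<subseteq> insert a I" "has_cube F J" "a \<in> J" for J
  proof -
    obtain p q where pq: "\<forall>i\<in>J. p i \<noteq> q i" "\<forall>A\<subseteq>J. (\<lambda>i. if i \<in> A then q i else p i) \<in> F"
      using J(2) by (auto simp: has_cube_def)
    have 1: "\<forall>A\<subseteq>J - {a}. (\<lambda>i. if i \<in> A then q i else p i) \<in> G (p a)"
      using pq(2) by (auto simp: G_def)
    \<comment> \<open>The face with \<open>a\<close> switched on is a cube whose base point takes
      the value \<open>q a\<close> at \<open>a\<close>.\<close>
    have 2: "(\<lambda>i. if i \<in> A then q i else (p(a := q a)) i) \<in> G (q a)" if "A \<subseteq> J - {a}" for A
    proof -
      have "insert a A \<subseteq> J" using that J(3) by auto
      moreover have "(\<lambda>i. if i \<in> A then q i else (p(a := q a)) i)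
          = (\<lambda>i. if i \<in> insert a A then q i else p i)" by auto
      ultimately have "(\<lambda>i. if i \<in> A then q i else (p(a := q a)) i) \<in> F" using pq(2) by metis
      then show ?thesis by (simp add: G_def)
    qed
    have "J - {a} \<in> C (p a)" using 1 pq(1) J by (auto simp: C_def has_cube_def)
    moreover have "J - {a} \<in> C (q a)"
      unfolding C_def has_cube_def using 2 pq(1) J(1)
      by (intro CollectI conjI exI[of _ "p(a := q a)"] exI[of _ q]) auto
    ultimately show ?thesis using pq(1) J(3) by blast
  qed
  have finV: "finite V" using insert.prems by (simp add: V_def)
  have finC: "finite (C v)" for v
    using insert.hyps(1) by (auto simp: C_def intro: finite_subset[of _ "Pow I"])
  have "inj_on h {J. J \<subseteq> insert a I \<and> has_cube F J}"
  proof (rule inj_onI)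
    fix J J' assume J: "J \<in> {J. J \<subseteq> insert a I \<and> has_cube F J}"
      "J' \<in> {J. J \<subseteq> insert a I \<and> has_cube F J}" and eq: "h J = h J'"
    have mixed: False if K: "K \<subseteq> insert a I" "has_cube F K" "a \<in> K" "a \<notin> K'" "h K = h K'" for K K'
    proof -
      have "snd_v (K - {a}) = fst_v (K - {a})" using K by (auto simp: h_def)
      moreover obtain v v' where "v \<noteq> v'" "K - {a} \<in> C v" "K - {a} \<in> C v'"
        using with_a[OF K(1-3)] by blast
      ultimately show False using snd_prop by metis
    qed
    show "J = J'"
    proof (cases "a \<in> J \<longleftrightarrow> a \<in> J'")
      case True
      then show ?thesis using eq by (cases "a \<in> J") (auto simp: h_def)
    next
      case False
      then show ?thesis using mixed[of J J'] mixed[of J' J] J eq by auto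
    qed
  qed
  moreover have "h ` {J. J \<subseteq> insert a I \<and> has_cube F J} \<subseteq> Sigma V C"
  proof
    fix y assume "y \<in> h ` {J. J \<subseteq> insert a I \<and> has_cube F J}"
    then obtain J where J: "J \<subseteq> insert a I" "has_cube F J" "y = h J" by auto
    show "y \<in> Sigma V C"
    proof (cases "a \<in> J")
      case True
      obtain v v' where "v \<noteq> v'" "J - {a} \<in> C v" "J - {a} \<in> C v'"
        using with_a[OF J(1,2) True] by blast
      then have "snd_v (J - {a}) \<in> V \<and> J - {a} \<in> C (snd_v (J - {a}))" using snd_prop by metis
      then show ?thesis using J(3) True by (simp add: h_def)
    next
      case False
      then have "fst_v J \<in> V \<and> J \<in> C (fst_v J)" using without_a[OF J(1,2)] fst_prop by metis
      then show ?thesis using J(3) False by (simp add: h_def)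
    qed
  qed
  moreover have "finite (Sigma V C)" using finV finC by auto
  ultimately have "card {J. J \<subseteq> insert a I \<and> has_cube F J} \<le> card (Sigma V C)"
    by (metis card_inj_on_le)
  also have "\<dots> = (\<Sum>v\<in>V. card (C v))" using finV finC by simp
  also have "\<dots> \<le> (\<Sum>v\<in>V. card (G v))"
    using insert.IH[of "G _"] insert.prems by (intro sum_mono) (auto simp: C_def G_def)
  also have "\<dots> = card (\<Union>v\<in>V. G v)"
    using finV insert.prems by (subst card_UN_disjoint) (auto simp: G_def)
  also have "(\<Union>v\<in>V. G v) = F" by (auto simp: G_def V_def)
  finally show ?case .
qed

lemma card_subsets_le:
  assumes "finite I"
  shows "card {J. J \<subseteq> I \<and> card J \<le> n} = (\<Sum>j\<le>n. card I choose j)"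
proof -
  have "{J. J \<subseteq> I \<and> card J \<le> n} = (\<Union>j\<in>{..n}. {J. J \<subseteq> I \<and> card J = j})" by auto
  also have "card \<dots> = (\<Sum>j\<le>n. card {J. J \<subseteq> I \<and> card J = j})"
    using assms by (intro card_UN_disjoint) auto
  finally show ?thesis using assms by (simp add: n_subsets)
qed

subsection \<open>Linear programs attain their minimum\<close>

text \<open>The ratio test of the simplex method: along a descent direction that keeps the tight
  constraints tight, boundedness from below forces another constraint to block the way, and stopping
  at the first such constraint enlarges the tight set.\<close>

lemma linear_program_step:
  fixes g :: "'a::euclidean_space"
  assumes "finite S" and bd: "\<And>y. \<forall>s\<in>S. c s \<bullet> y \<le> \<beta> s \<Longrightarrow> m \<le> g \<bullet> y"
    and x: "\<forall>s\<in>S. c s \<bullet> x \<le> \<beta> s"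
    and d: "\<forall>s\<in>S. c s \<bullet> x = \<beta> s \<longrightarrow> c s \<bullet> d = 0" and gd: "g \<bullet> d < 0"
  shows "\<exists>y. (\<forall>s\<in>S. c s \<bullet> y \<le> \<beta> s) \<and> g \<bullet> y \<le> g \<bullet> x \<and>
     {s\<in>S. c s \<bullet> x = \<beta> s} \<subset> {s\<in>S. c s \<bullet> y = \<beta> s}"
proof -
  define B where "B = {s\<in>S. c s \<bullet> d > 0}"
  define r where "r s = (\<beta> s - c s \<bullet> x) / (c s \<bullet> d)" for s
  have finB: "finite B" using assms(1) by (simp add: B_def)
  have "B \<noteq> {}"
  proof
    assume "B = {}"
    \<comment> \<open>With this step length the objective at \<open>x + t *\<^sub>R d\<close> is at
      most \<open>- \<bar>m\<bar> - 1\<close>, which is less than \<open>m\<close>.\<close>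
    define t where "t = (\<bar>m\<bar> + \<bar>g \<bullet> x\<bar> + 1) / - (g \<bullet> d)"
    have t: "t \<ge> 0" using gd by (auto simp: t_def divide_simps)
    have "\<forall>s\<in>S. c s \<bullet> (x + t *\<^sub>R d) \<le> \<beta> s"
    proof
      fix s assume s: "s \<in> S"
      then have "c s \<bullet> d \<le> 0" using \<open>B = {}\<close> by (force simp: B_def)
      then have "t * (c s \<bullet> d) \<le> 0" using t by (simp add: mult_nonneg_nonpos)
      moreover have "c s \<bullet> x \<le> \<beta> s" using x s by auto
      ultimately show "c s \<bullet> (x + t *\<^sub>R d) \<le> \<beta> s" by (simp add: inner_add_right)
    qed
    then have "m \<le> g \<bullet> (x + t *\<^sub>R d)" by (rule bd)
    then have "m \<le> g \<bullet> x + t * (g \<bullet> d)" by (simp add: inner_add_right)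
    moreover have "t * (g \<bullet> d) = - (\<bar>m\<bar> + \<bar>g \<bullet> x\<bar> + 1)" using gd by (simp add: t_def)
    ultimately show False by linarith
  qed
  define t where "t = Min (r ` B)"
  have "t \<in> r ` B" unfolding t_def using finB \<open>B \<noteq> {}\<close> by (intro Min_in) auto
  then obtain s0 where s0: "s0 \<in> B" "t = r s0" by blast
  have t_le: "t \<le> r s" if "s \<in> B" for s using that finB by (simp add: t_def)
  have t0: "t \<ge> 0" using s0 x by (auto simp: r_def B_def)
  let ?y = "x + t *\<^sub>R d"
  have "c s \<bullet> ?y \<le> \<beta> s" if s: "s \<in> S" for s
  proof (cases "s \<in> B")
    case True
    then have "t * (c s \<bullet> d) \<le> r s * (c s \<bullet> d)" using t_le[OF True] by (simp add: B_def)
    also have "\<dots> = \<beta> s - c s \<bullet> x" using True by (simp add: r_def B_def)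
    finally show ?thesis by (simp add: inner_add_right)
  next
    case False
    then have "t * (c s \<bullet> d) \<le> 0" using t0 s by (simp add: B_def mult_nonneg_nonpos)
    moreover have "c s \<bullet> x \<le> \<beta> s" using x s by auto
    ultimately show ?thesis by (simp add: inner_add_right)
  qed
  moreover have "g \<bullet> ?y \<le> g \<bullet> x"
    using t0 gd by (simp add: inner_add_right mult_nonneg_nonpos)
  moreover have "{s\<in>S. c s \<bullet> x = \<beta> s} \<subseteq> {s\<in>S. c s \<bullet> ?y = \<beta> s}"
    using d by (auto simp: inner_add_right)
  moreover have "c s0 \<bullet> ?y = \<beta> s0" "c s0 \<bullet> x \<noteq> \<beta> s0" "s0 \<in> S"
    using s0 d by (auto simp: r_def B_def inner_add_right)
  ultimately show ?thesis by blast
qed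

text \<open>The feasible set may be unbounded and without vertices, so compactness and vertices are
  not at hand. Instead every point descends to one where the tight constraints determine the
  objective, and such points yield only finitely many values.\<close>

lemma linear_program_attains_min:
  fixes g :: "'a::euclidean_space"
  assumes "finite S" and bd: "\<And>y. \<forall>s\<in>S. c s \<bullet> y \<le> \<beta> s \<Longrightarrow> m \<le> g \<bullet> y"
    and ne: "\<forall>s\<in>S. c s \<bullet> x0 \<le> \<beta> s"
  obtains x where "\<forall>s\<in>S. c s \<bullet> x \<le> \<beta> s" "\<And>y. \<forall>s\<in>S. c s \<bullet> y \<le> \<beta> s \<Longrightarrow> g \<bullet> x \<le> g \<bullet> y"
proof -
  define P where "P = {y. \<forall>s\<in>S. c s \<bullet> y \<le> \<beta> s}"
  define T where "T y = {s\<in>S. c s \<bullet> y = \<beta> s}" for y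
  \<comment> \<open>\<open>X\<close> stands in for the vertices: at its points no direction along
    the tight constraints changes the objective.\<close>
  define X where "X = {y\<in>P. \<forall>d. (\<forall>s\<in>T y. c s \<bullet> d = 0) \<longrightarrow> g \<bullet> d = 0}"
  have TS: "T y \<subseteq> S" for y by (auto simp: T_def)
  have descend: "\<exists>z\<in>X. g \<bullet> z \<le> g \<bullet> y" if "y \<in> P" for y
    using that
  proof (induction "card S - card (T y)" arbitrary: y rule: less_induct)
    case less
    show ?case
    proof (cases "y \<in> X")
      case False
      then obtain d where d: "\<forall>s\<in>T y. c s \<bullet> d = 0" "g \<bullet> d \<noteq> 0" using less.prems by (auto simp: X_def)
      obtain d where d: "\<forall>s\<in>T y. c s \<bullet> d = 0" "g \<bullet> d < 0"
      proof (cases "g \<bullet> d < 0")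
        case True then show ?thesis using d that by auto
      next
        case False then show ?thesis using d that[of "- d"] by auto
      qed
      have "\<exists>z. (\<forall>s\<in>S. c s \<bullet> z \<le> \<beta> s) \<and> g \<bullet> z \<le> g \<bullet> y \<and>
          {s\<in>S. c s \<bullet> y = \<beta> s} \<subset> {s\<in>S. c s \<bullet> z = \<beta> s}"
        using less.prems d by (intro linear_program_step[OF assms(1) bd]) (auto simp: T_def P_def)
      then obtain z where z: "z \<in> P" "g \<bullet> z \<le> g \<bullet> y" "T y \<subset> T z"
        by (auto simp: P_def T_def)
      have "card (T y) < card (T z)" "card (T z) \<le> card S"
        using z(3) TS assms(1) by (meson psubset_card_mono finite_subset, meson card_mono)
      then have "card S - card (T z) < card S - card (T y)" by linarith
      then obtain u where "u \<in> X" "g \<bullet> u \<le> g \<bullet> z" using less.hyps[of z] z(1) by blast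
      then show ?thesis using z by force
    qed auto
  qed
  have eq: "g \<bullet> y = g \<bullet> z" if "y \<in> X" "z \<in> X" "T y = T z" for y z
  proof -
    have "\<forall>s\<in>T y. c s \<bullet> (y - z) = 0" using that(3) by (auto simp: T_def inner_diff_right set_eq_iff)
    then have "g \<bullet> (y - z) = 0" using that(1) by (auto simp: X_def)
    then show ?thesis by (simp add: inner_diff_right)
  qed
  have "finite (T ` X)" using TS assms(1) by (auto intro: finite_subset[of _ "Pow S"])
  moreover have "(\<bullet>) g ` X = (\<lambda>A. g \<bullet> (SOME y. y \<in> X \<and> T y = A)) ` (T ` X)"
  proof -
    have "g \<bullet> (SOME z. z \<in> X \<and> T z = T y) = g \<bullet> y" if "y \<in> X" for y
      using someI[of "\<lambda>z. z \<in> X \<and> T z = T y" y] eq that by blast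
    then show ?thesis by (auto simp: image_image intro!: image_cong)
  qed
  ultimately have fin: "finite ((\<bullet>) g ` X)" by simp
  have "x0 \<in> P" using ne by (simp add: P_def)
  then have "X \<noteq> {}" using descend by blast
  then obtain x where x: "x \<in> X" "g \<bullet> x = Min ((\<bullet>) g ` X)"
    using Min_in[OF fin] by (metis (no_types, lifting) image_iff image_is_empty)
  show ?thesis
  proof
    show "\<forall>s\<in>S. c s \<bullet> x \<le> \<beta> s" using x by (auto simp: X_def P_def)
    fix y assume "\<forall>s\<in>S. c s \<bullet> y \<le> \<beta> s"
    then obtain z where "z \<in> X" "g \<bullet> z \<le> g \<bullet> y" using descend by (auto simp: P_def)
    then show "g \<bullet> x \<le> g \<bullet> y" using x fin by (metis Min_le image_eqI order_trans)
  qed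
qed

subsection \<open>Arrangements of maxout units in general position\<close>

text \<open>The index set \<open>E\<close> lists pieces compared with a base piece \<open>\<beta> i\<close> of their unit: at most
  dimension many weight differences are independent, and one more tie is impossible.\<close>

locale generic_arrangement =
  fixes w :: "nat \<Rightarrow> nat \<Rightarrow> 'a::euclidean_space" and b :: "nat \<Rightarrow> nat \<Rightarrow> real" and N K :: nat
  assumes K_ge_2: "2 \<le> K"
    and solvable: "\<And>\<beta> E c. \<lbrakk>\<And>i. i < N \<Longrightarrow> \<beta> i < K; E \<subseteq> {(i,k). i < N \<and> k < K \<and> k \<noteq> \<beta> i};
        card E \<le> DIM('a)\<rbrakk> \<Longrightarrow> \<exists>d. \<forall>(i,k)\<in>E. (w i k - w i (\<beta> i)) \<bullet> d = c (i,k)"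
    and unique: "\<And>\<beta> E d. \<lbrakk>\<And>i. i < N \<Longrightarrow> \<beta> i < K; E \<subseteq> {(i,k). i < N \<and> k < K \<and> k \<noteq> \<beta> i};
        card E = DIM('a); \<forall>(i,k)\<in>E. (w i k - w i (\<beta> i)) \<bullet> d = 0\<rbrakk> \<Longrightarrow> d = 0"
    and no_excess_tie: "\<And>\<beta> E x. \<lbrakk>\<And>i. i < N \<Longrightarrow> \<beta> i < K; E \<subseteq> {(i,k). i < N \<and> k < K \<and> k \<noteq> \<beta> i};
        card E = Suc DIM('a)\<rbrakk> \<Longrightarrow> \<exists>(i,k)\<in>E. w i k \<bullet> x + b i k \<noteq> w i (\<beta> i) \<bullet> x + b i (\<beta> i)"
begin

section \<open>Active pieces, cells and small perturbations\<close>

definition piece :: "nat \<Rightarrow> nat \<Rightarrow> 'a \<Rightarrow> real" where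
  "piece i k x = w i k \<bullet> x + b i k"

definition active :: "nat \<Rightarrow> 'a \<Rightarrow> nat set" where
  "active i x = {k. k < K \<and> (\<forall>k'<K. piece i k' x \<le> piece i k x)}"

definition closed_cell :: "(nat \<Rightarrow> nat) \<Rightarrow> 'a set" where
  "closed_cell p = {x. \<forall>i<N. p i \<in> active i x}"

definition open_cell :: "(nat \<Rightarrow> nat) \<Rightarrow> 'a set" where
  "open_cell p = {x. \<forall>i<N. active i x = {p i}}"

lemma active_less: "k \<in> active i x \<Longrightarrow> k < K"
  by (simp add: active_def)

lemma finite_active: "finite (active i x)"
  by (rule finite_subset[of _ "{..<K}"]) (auto simp: active_def)

lemma active_nonempty: "active i x \<noteq> {}"
proof -
  let ?M = "Max ((\<lambda>k. piece i k x) ` {..<K})"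
  have "?M \<in> (\<lambda>k. piece i k x) ` {..<K}" using K_ge_2 by (intro Max_in) (auto simp: lessThan_empty_iff)
  then obtain k where k: "k < K" "?M = piece i k x" by auto
  moreover have "piece i k' x \<le> ?M" if "k' < K" for k' using that by (intro Max_ge) auto
  ultimately show ?thesis by (auto simp: active_def)
qed

lemma active_choice: obtains \<beta> where "\<And>i. \<beta> i \<in> active i x"
  using that[of "\<lambda>i. SOME k. k \<in> active i x"] active_nonempty by (simp add: some_in_eq)

lemma piece_eq_of_active: "k \<in> active i x \<Longrightarrow> k' \<in> active i x \<Longrightarrow> piece i k x = piece i k' x"
  by (auto simp: active_def intro: antisym)

lemma piece_add: "piece i k (x + t *\<^sub>R d) = piece i k x + t * (w i k \<bullet> d)"
  by (simp add: piece_def inner_add_right)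

text \<open>Pieces below the maximum at \<open>x\<close> stay below it for small \<open>t\<close>,
  while the active ones start from a common value and are ordered by their slopes along
  \<open>d\<close>. One \<open>t\<close> has to serve all units, which \<open>eventually\<close>
  takes care of.\<close>

lemma active_perturb:
  "\<forall>\<^sub>F t in at_right 0. \<forall>i<N. active i (x + t *\<^sub>R d) =
     {k \<in> active i x. \<forall>k'\<in>active i x. w i k' \<bullet> d \<le> w i k \<bullet> d}"
proof -
  have ev: "\<forall>\<^sub>F t in at_right 0. \<forall>i\<in>{..<N}. \<forall>k\<in>{..<K}. \<forall>k'\<in>{..<K}.
      piece i k x < piece i k' x \<longrightarrow> piece i k (x + t *\<^sub>R d) < piece i k' (x + t *\<^sub>R d)"
  proof (intro eventually_ball_finite ballI finite_lessThan)
    fix i k k'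
    show "\<forall>\<^sub>F t in at_right 0. piece i k x < piece i k' x \<longrightarrow> piece i k (x + t *\<^sub>R d) < piece i k' (x + t *\<^sub>R d)"
    proof (cases "piece i k x < piece i k' x")
      case True
      have "((\<lambda>t. piece i k' (x + t *\<^sub>R d) - piece i k (x + t *\<^sub>R d)) \<longlongrightarrow>
          piece i k' (x + 0 *\<^sub>R d) - piece i k (x + 0 *\<^sub>R d)) (at_right 0)"
        unfolding piece_def by (intro tendsto_intros)
      then have "\<forall>\<^sub>F t in at_right 0. 0 < piece i k' (x + t *\<^sub>R d) - piece i k (x + t *\<^sub>R d)"
        by (rule order_tendstoD) (use True in simp)
      then show ?thesis by eventually_elim simp
    qed simp
  qed
  have pos: "\<forall>\<^sub>F t in at_right 0. 0 < (t::real)" by (simp add: eventually_at_right_less)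
  from ev pos show ?thesis
  proof eventually_elim
    case (elim t)
    show ?case
    proof (intro allI impI set_eqI iffI)
      fix i k assume i: "i < N" and k: "k \<in> active i (x + t *\<^sub>R d)"
      have kK: "k < K" using k by (rule active_less)
      have kx: "k \<in> active i x"
      proof (rule ccontr)
        assume "k \<notin> active i x"
        then obtain k' where "k' < K" "piece i k x < piece i k' x" using kK by (auto simp: active_def not_le)
        then have "piece i k (x + t *\<^sub>R d) < piece i k' (x + t *\<^sub>R d)" using elim i kK by auto
        then show False using k \<open>k' < K\<close> by (auto simp: active_def not_le[symmetric])
      qed
      moreover have "w i k' \<bullet> d \<le> w i k \<bullet> d" if k': "k' \<in> active i x" for k'
      proof -
        have "piece i k' (x + t *\<^sub>R d) \<le> piece i k (x + t *\<^sub>R d)"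
          using k active_less[OF k'] by (auto simp: active_def)
        then have "t * (w i k' \<bullet> d) \<le> t * (w i k \<bullet> d)"
          using piece_eq_of_active[OF k' kx] by (simp add: piece_add)
        then show ?thesis using elim by simp
      qed
      ultimately show "k \<in> {k \<in> active i x. \<forall>k'\<in>active i x. w i k' \<bullet> d \<le> w i k \<bullet> d}" by auto
    next
      fix i k assume i: "i < N" and k: "k \<in> {k \<in> active i x. \<forall>k'\<in>active i x. w i k' \<bullet> d \<le> w i k \<bullet> d}"
      then have kK: "k < K" and kx: "k \<in> active i x" using active_less by auto
      have "piece i k' (x + t *\<^sub>R d) \<le> piece i k (x + t *\<^sub>R d)" if k': "k' < K" for k'
      proof (cases "k' \<in> active i x")
        case True
        then have "t * (w i k' \<bullet> d) \<le> t * (w i k \<bullet> d)" using k elim by simp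
        then show ?thesis using piece_eq_of_active[OF True kx] by (simp add: piece_add)
      next
        case False
        then obtain k'' where "k'' < K" "piece i k' x < piece i k'' x"
          using k' by (auto simp: active_def not_le)
        then have "piece i k' x < piece i k x" using kx by (auto simp: active_def intro: less_le_trans)
        then show ?thesis using elim i kK k' by (simp add: less_imp_le)
      qed
      then show "k \<in> active i (x + t *\<^sub>R d)" using kK by (simp add: active_def)
    qed
  qed
qed

lemma open_open_cell:
  assumes "\<And>i. i < N \<Longrightarrow> p i < K"
  shows "open (open_cell p)"
proof -
  have "active i x = {p i} \<longleftrightarrow> (\<forall>k\<in>{..<K} - {p i}. piece i k x < piece i (p i) x)" if i: "i < N" for i x
  proof
    assume act: "active i x = {p i}"
    show "\<forall>k\<in>{..<K} - {p i}. piece i k x < piece i (p i) x"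
    proof
      fix k assume k: "k \<in> {..<K} - {p i}"
      then obtain k' where k': "k' < K" "piece i k x < piece i k' x"
        using act by (force simp: active_def not_le)
      have "p i \<in> active i x" using act by simp
      then have "piece i k' x \<le> piece i (p i) x" using k'(1) by (simp add: active_def)
      then show "piece i k x < piece i (p i) x" using k'(2) by linarith
    qed
  next
    assume less: "\<forall>k\<in>{..<K} - {p i}. piece i k x < piece i (p i) x"
    have "piece i k x \<le> piece i (p i) x" if "k < K" for k using less that by (cases "k = p i") (auto simp: less_imp_le)
    then have "p i \<in> active i x" using assms[OF i] by (simp add: active_def)
    moreover have "k = p i" if k: "k \<in> active i x" for k
    proof (rule ccontr)
      assume "k \<noteq> p i"
      then have "piece i k x < piece i (p i) x" using less active_less[OF k] by auto
      moreover have "piece i (p i) x \<le> piece i k x" using k assms[OF i] by (simp add: active_def)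
      ultimately show False by simp
    qed
    ultimately show "active i x = {p i}" by blast
  qed
  then have "open_cell p = (\<Inter>i\<in>{..<N}. \<Inter>k\<in>{..<K} - {p i}. {x. piece i k x < piece i (p i) x})"
    by (auto simp: open_cell_def)
  moreover have "open {x. piece i k x < piece i (p i) x}" for i k
    unfolding piece_def by (intro open_Collect_less continuous_intros)
  ultimately show ?thesis by (auto intro!: open_INT)
qed

section \<open>Tie equations and simultaneous ties\<close>

definition ties :: "(nat \<Rightarrow> nat) \<Rightarrow> nat set \<Rightarrow> 'a \<Rightarrow> (nat \<times> nat) set" where
  "ties \<beta> J x = {(i,k). i \<in> J \<and> k \<in> active i x \<and> k \<noteq> \<beta> i}"

lemma ties_eq_Sigma: "ties \<beta> J x = Sigma J (\<lambda>i. active i x - {\<beta> i})"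
  by (auto simp: ties_def)

lemma ties_subset: "J \<subseteq> {..<N} \<Longrightarrow> ties \<beta> J x \<subseteq> {(i,k). i < N \<and> k < K \<and> k \<noteq> \<beta> i}"
  using active_less by (auto simp: ties_def)

lemma finite_ties: "J \<subseteq> {..<N} \<Longrightarrow> finite (ties \<beta> J x)"
  using finite_active finite_subset[of J "{..<N}"] by (auto simp: ties_eq_Sigma)

lemma card_ties:
  assumes "J \<subseteq> {..<N}" "\<And>i. i \<in> J \<Longrightarrow> \<beta> i \<in> active i x"
  shows "card (ties \<beta> J x) = (\<Sum>i\<in>J. card (active i x) - 1)"
proof -
  have "card (ties \<beta> J x) = (\<Sum>i\<in>J. card (active i x - {\<beta> i}))"
    unfolding ties_eq_Sigma using assms finite_active finite_subset[of J "{..<N}"]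
    by (intro card_SigmaI) auto
  also have "\<dots> = (\<Sum>i\<in>J. card (active i x) - 1)"
    using assms finite_active by (intro sum.cong) auto
  finally show ?thesis .
qed

text \<open>The ties at a point are equations of the kind counted by the locale, relative to active
  base pieces; \<open>Suc DIM('a)\<close> of them holding at once would contradict
  \<open>no_excess_tie\<close>.\<close>

lemma card_ties_le:
  assumes J: "J \<subseteq> {..<N}" and \<beta>: "\<And>i. i < N \<Longrightarrow> \<beta> i \<in> active i x"
  shows "card (ties \<beta> J x) \<le> DIM('a)"
proof (rule ccontr)
  assume "\<not> ?thesis"
  then obtain E where E: "E \<subseteq> ties \<beta> J x" "card E = Suc DIM('a)"
    by (metis not_less_eq_eq obtain_subset_with_card_n)
  have "\<exists>(i,k)\<in>E. w i k \<bullet> x + b i k \<noteq> w i (\<beta> i) \<bullet> x + b i (\<beta> i)"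
    using E ties_subset[OF J] active_less[OF \<beta>] by (intro no_excess_tie) auto
  then obtain i k where ik: "(i,k) \<in> E" "piece i k x \<noteq> piece i (\<beta> i) x" by (auto simp: piece_def)
  then have "i < N" "k \<in> active i x" using E J by (auto simp: ties_def)
  then show False using ik \<beta> piece_eq_of_active by blast
qed

text \<open>There are few enough tie equations at \<open>x\<close> to prescribe a direction along
  which each active competitor of \<open>s i\<close> loses ground at rate 1; a small step in this
  direction leaves \<open>s i\<close> as the only active piece.\<close>

lemma open_cell_nonempty:
  assumes s: "\<And>i. i < N \<Longrightarrow> s i \<in> active i x"
  shows "open_cell s \<noteq> {}"
proof -
  let ?E = "ties s {..<N} x"
  have "\<exists>d. \<forall>(i,k)\<in>?E. (w i k - w i (s i)) \<bullet> d = (\<lambda>_. -1) (i,k)"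
    using s active_less by (intro solvable ties_subset card_ties_le) auto
  then obtain d where d: "\<forall>(i,k)\<in>?E. (w i k - w i (s i)) \<bullet> d = -1" by auto
  have eq: "{k \<in> active i x. \<forall>k'\<in>active i x. w i k' \<bullet> d \<le> w i k \<bullet> d} = {s i}" if i: "i < N" for i
  proof -
    have less: "w i k \<bullet> d < w i (s i) \<bullet> d" if "k \<in> active i x" "k \<noteq> s i" for k
    proof -
      have "(i,k) \<in> ?E" using i that by (auto simp: ties_def)
      then have "(w i k - w i (s i)) \<bullet> d = -1" using d by auto
      then show ?thesis by (simp add: inner_diff_left)
    qed
    show ?thesis
    proof (intro set_eqI iffI)
      fix k assume "k \<in> {k \<in> active i x. \<forall>k'\<in>active i x. w i k' \<bullet> d \<le> w i k \<bullet> d}"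
      then show "k \<in> {s i}" using less[of k] s[OF i] by force
    next
      fix k assume "k \<in> {s i}"
      then show "k \<in> {k \<in> active i x. \<forall>k'\<in>active i x. w i k' \<bullet> d \<le> w i k \<bullet> d}"
        using less s[OF i] by (auto simp: less_imp_le) (metis less_imp_le order_refl)
    qed
  qed
  have "\<exists>t. \<forall>i<N. active i (x + t *\<^sub>R d) =
      {k \<in> active i x. \<forall>k'\<in>active i x. w i k' \<bullet> d \<le> w i k \<bullet> d}"
    by (rule eventually_happens'[OF _ active_perturb]) simp
  then obtain t where "\<forall>i<N. active i (x + t *\<^sub>R d) = {s i}" using eq by auto
  then have "x + t *\<^sub>R d \<in> open_cell s" by (simp add: open_cell_def)
  then show ?thesis by auto
qed

text \<open>The set of competitors is not convex, but it is a finite union of polyhedra, one for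
  each choice of two tied pieces per unit of \<open>J\<close>. Each nonempty polyhedron has a
  minimiser, and the best of these is taken. The functional is the gap between pieces
  \<open>k\<close> and \<open>k'\<close> of unit \<open>m\<close> up to a constant.\<close>

lemma tied_minimizer:
  assumes J: "J \<subseteq> {..<N}" and k': "k' < K"
    and x1: "\<forall>i\<in>J. 2 \<le> card (active i x1)" "k \<in> active m x1"
  obtains x where "\<forall>i\<in>J. 2 \<le> card (active i x)" "k \<in> active m x"
    "\<And>y. \<lbrakk>\<forall>i\<in>J. 2 \<le> card (active i y); k \<in> active m y\<rbrakk>
      \<Longrightarrow> (w m k - w m k') \<bullet> x \<le> (w m k - w m k') \<bullet> y"
proof -
  define g where "g = w m k - w m k'"
  define \<Phi> where "\<Phi> = PiE J (\<lambda>_. {(p,q). p < K \<and> q < K \<and> p \<noteq> q})"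
  define P where "P \<phi> = {x. (\<forall>i\<in>J. fst (\<phi> i) \<in> active i x \<and> snd (\<phi> i) \<in> active i x) \<and> k \<in> active m x}" for \<phi>
  define \<Gamma> where "\<Gamma> = {x. (\<forall>i\<in>J. 2 \<le> card (active i x)) \<and> k \<in> active m x}"
  have kK: "k < K" using x1 active_less by blast
  have finJ: "finite J" using J finite_subset by blast
  have fin\<Phi>: "finite \<Phi>" unfolding \<Phi>_def
    by (intro finite_PiE finJ) (rule finite_subset[of _ "{..<K} \<times> {..<K}"], auto)
  have cover: "\<exists>\<phi>\<in>\<Phi>. x \<in> P \<phi>" if x: "x \<in> \<Gamma>" for x
  proof -
    have "\<exists>p q. p \<in> active i x \<and> q \<in> active i x \<and> p \<noteq> q" if "i \<in> J" for i
    proof -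
      have "2 \<le> card (active i x)" using x that by (auto simp: \<Gamma>_def)
      then obtain T where "T \<subseteq> active i x" "card T = 2" by (metis obtain_subset_with_card_n)
      then show ?thesis by (auto simp: card_2_iff)
    qed
    then obtain p q where pq: "\<And>i. i \<in> J \<Longrightarrow> p i \<in> active i x \<and> q i \<in> active i x \<and> p i \<noteq> q i" by metis
    let ?\<phi> = "restrict (\<lambda>i. (p i, q i)) J"
    have "?\<phi> \<in> \<Phi>" using pq active_less by (fastforce simp: \<Phi>_def)
    moreover have "x \<in> P ?\<phi>" using pq x by (auto simp: P_def \<Gamma>_def)
    ultimately show ?thesis by blast
  qed
  have sub: "P \<phi> \<subseteq> \<Gamma>" if "\<phi> \<in> \<Phi>" for \<phi>
  proof
    fix x assume x: "x \<in> P \<phi>"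
    have "2 \<le> card (active i x)" if i: "i \<in> J" for i
    proof -
      have "card {fst (\<phi> i), snd (\<phi> i)} = 2" using \<open>\<phi> \<in> \<Phi>\<close> i by (force simp: \<Phi>_def card_2_iff)
      moreover have "{fst (\<phi> i), snd (\<phi> i)} \<subseteq> active i x" using x i by (auto simp: P_def)
      ultimately show ?thesis using card_mono[OF finite_active] by metis
    qed
    then show "x \<in> \<Gamma>" using x by (auto simp: \<Gamma>_def P_def)
  qed
  have min: "\<exists>x\<in>P \<phi>. \<forall>y\<in>P \<phi>. g \<bullet> x \<le> g \<bullet> y" if \<phi>: "\<phi> \<in> \<Phi>" "P \<phi> \<noteq> {}" for \<phi>
  proof -
    \<comment> \<open>A triple \<open>(i,p,q)\<close> demands that piece \<open>p\<close> of unit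
      \<open>i\<close> be at least piece \<open>q\<close>.\<close>
    define S where "S = {(i,p,q). q < K \<and> (i \<in> J \<and> (p = fst (\<phi> i) \<or> p = snd (\<phi> i)) \<or> i = m \<and> p = k)}"
    define c where "c = (\<lambda>(i,p,q). w i q - w i p)"
    define \<beta> where "\<beta> = (\<lambda>(i,p,q). b i p - b i q)"
    have \<phi>K: "fst (\<phi> i) < K \<and> snd (\<phi> i) < K" if "i \<in> J" for i
      using \<phi>(1) that by (force simp: \<Phi>_def)
    have "S \<subseteq> insert m J \<times> {..<K} \<times> {..<K}" using \<phi>K kK by (auto simp: S_def)
    then have finS: "finite S" using finJ by (meson finite_SigmaI finite_insert finite_lessThan finite_subset)
    have iff: "(\<forall>s\<in>S. c s \<bullet> x \<le> \<beta> s) \<longleftrightarrow> x \<in> P \<phi>" for x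
    proof -
      have 1: "c (i,p,q) \<bullet> x \<le> \<beta> (i,p,q) \<longleftrightarrow> piece i q x \<le> piece i p x" for i p q
        by (auto simp: c_def \<beta>_def piece_def inner_diff_left)
      have "(\<forall>s\<in>S. c s \<bullet> x \<le> \<beta> s) \<longleftrightarrow> (\<forall>(i,p,q)\<in>S. piece i q x \<le> piece i p x)"
        using 1 by (intro ball_cong) auto
      also have "\<dots> \<longleftrightarrow> x \<in> P \<phi>"
        using \<phi>K kK by (auto simp: S_def P_def active_def)
      finally show ?thesis .
    qed
    \<comment> \<open>The gap is nonnegative wherever \<open>k\<close> is active, which bounds its
      linear part from below.\<close>
    have bd: "b m k' - b m k \<le> g \<bullet> y" if "\<forall>s\<in>S. c s \<bullet> y \<le> \<beta> s" for y
    proof -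
      have "piece m k' y \<le> piece m k y" using that k' by (auto simp: iff P_def active_def)
      then show ?thesis by (simp add: piece_def g_def inner_diff_left)
    qed
    obtain x0 where "\<forall>s\<in>S. c s \<bullet> x0 \<le> \<beta> s" using \<phi>(2) iff by blast
    from linear_program_attains_min[OF finS bd this] show ?thesis using iff by metis
  qed
  define X where "X \<phi> = (SOME x. x \<in> P \<phi> \<and> (\<forall>y\<in>P \<phi>. g \<bullet> x \<le> g \<bullet> y))" for \<phi>
  have X: "X \<phi> \<in> P \<phi> \<and> (\<forall>y\<in>P \<phi>. g \<bullet> X \<phi> \<le> g \<bullet> y)" if "\<phi> \<in> \<Phi>" "P \<phi> \<noteq> {}" for \<phi>
    unfolding X_def by (rule someI_ex) (use min[OF that] in blast)
  let ?\<Phi> = "{\<phi>\<in>\<Phi>. P \<phi> \<noteq> {}}"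
  have "x1 \<in> \<Gamma>" using x1 by (auto simp: \<Gamma>_def)
  then have "?\<Phi> \<noteq> {}" using cover by fastforce
  then obtain \<phi> where \<phi>: "\<phi> \<in> ?\<Phi>" "\<And>\<psi>. \<psi> \<in> ?\<Phi> \<Longrightarrow> g \<bullet> X \<phi> \<le> g \<bullet> X \<psi>"
    using ex_min_if_finite[of "(\<lambda>\<phi>. g \<bullet> X \<phi>) ` ?\<Phi>"] fin\<Phi> by (auto simp: not_less)
  show ?thesis
  proof
    have "X \<phi> \<in> \<Gamma>" using X \<phi>(1) sub by blast
    then show "\<forall>i\<in>J. 2 \<le> card (active i (X \<phi>))" "k \<in> active m (X \<phi>)" by (auto simp: \<Gamma>_def)
    fix y assume "\<forall>i\<in>J. 2 \<le> card (active i y)" "k \<in> active m y"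
    then obtain \<psi> where "\<psi> \<in> \<Phi>" "y \<in> P \<psi>" using cover by (auto simp: \<Gamma>_def)
    then have "g \<bullet> X \<phi> \<le> g \<bullet> X \<psi>" "g \<bullet> X \<psi> \<le> g \<bullet> y" using \<phi>(2) X by blast+
    then show "(w m k - w m k') \<bullet> X \<phi> \<le> (w m k - w m k') \<bullet> y" by (simp add: g_def)
  qed
qed

text \<open>Suppose unit \<open>m\<close> is untied at the minimiser \<open>x\<close>. With fewer
  than \<open>DIM('a)\<close> ties, one more equation can be prescribed and gives a descent
  direction. With exactly \<open>DIM('a)\<close> ties, some unit has three active pieces; lowering
  each of them in turn yields directions whose effects on the gap are nonnegative and cancel, so all
  vanish, and \<open>unique\<close> is violated.\<close>

lemma crossing_exists:
  assumes "J \<subseteq> {..<N}" "card J \<le> DIM('a)"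
  shows "\<exists>x. \<forall>i\<in>J. 2 \<le> card (active i x)"
proof -
  have "finite J" using assms(1) finite_subset by blast
  then show ?thesis using assms
  proof (induction J rule: finite_induct)
    case empty
    show ?case by simp
  next
    case (insert m J)
    have J: "J \<subseteq> {..<N}" and m: "m < N" and cardJ: "card J < DIM('a)"
      using insert.prems insert.hyps by auto
    then obtain x1 where x1: "\<forall>i\<in>J. 2 \<le> card (active i x1)" using insert.IH by auto
    obtain k where k: "k \<in> active m x1" using active_nonempty by blast
    define k' where "k' = (if k = 0 then 1 else 0 :: nat)"
    have kk': "k' < K" "k' \<noteq> k" "k < K" using K_ge_2 active_less[OF k] by (auto simp: k'_def)
    define g where "g = w m k - w m k'"
    obtain x where x: "\<forall>i\<in>J. 2 \<le> card (active i x)" "k \<in> active m x"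
      and min: "\<And>y. \<lbrakk>\<forall>i\<in>J. 2 \<le> card (active i y); k \<in> active m y\<rbrakk> \<Longrightarrow> g \<bullet> x \<le> g \<bullet> y"
      using tied_minimizer[OF J kk'(1) x1 k] unfolding g_def by metis
    show ?case
    proof (cases "2 \<le> card (active m x)")
      case True
      then show ?thesis using x by auto
    next
      case False
      then have am: "active m x = {k}"
        using x(2) finite_active card_le_Suc0_iff_eq[OF finite_active, of m x] by (auto simp: not_le)
      obtain \<beta> where \<beta>: "\<And>i. \<beta> i \<in> active i x" using active_choice[of x] by metis
      have \<beta>m: "\<beta> m = k" using \<beta>[of m] am by auto
      have \<beta>K: "\<beta> i < K" for i using \<beta> active_less by blast
      let ?E = "ties \<beta> J x"
      have E: "?E \<subseteq> {(i,k). i < N \<and> k < K \<and> k \<noteq> \<beta> i}" "finite ?E" "card ?E \<le> DIM('a)"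
        using ties_subset finite_ties card_ties_le J \<beta> by auto
      have mE: "(m,k') \<notin> ?E" using insert.hyps by (auto simp: ties_def)
      have mE': "insert (m,k') F \<subseteq> {(i,k). i < N \<and> k < K \<and> k \<noteq> \<beta> i}" if "F \<subseteq> ?E" for F
        using that E(1) kk' m \<beta>m by auto
      \<comment> \<open>Since \<open>k\<close> is the only active piece of unit \<open>m\<close> at
        \<open>x\<close>, it stays active after a small step; so the step leads to another
        competitor as soon as the units of \<open>J\<close> remain tied.\<close>
      have local_min: "0 \<le> g \<bullet> d"
        if d: "\<And>i. i \<in> J \<Longrightarrow> 2 \<le> card {k \<in> active i x. \<forall>k'\<in>active i x. w i k' \<bullet> d \<le> w i k \<bullet> d}" for d
      proof -
        have "\<forall>\<^sub>F t in at_right (0::real). 0 < t" by (simp add: eventually_at_right_less)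
        with active_perturb[of x d]
        have "\<forall>\<^sub>F t in at_right 0. 0 < t \<and> (\<forall>i<N. active i (x + t *\<^sub>R d) =
            {k \<in> active i x. \<forall>k'\<in>active i x. w i k' \<bullet> d \<le> w i k \<bullet> d})"
          by eventually_elim simp
        from eventually_happens'[OF _ this] obtain t where t: "0 < t" "\<And>i. i < N \<Longrightarrow> active i (x + t *\<^sub>R d) =
            {k \<in> active i x. \<forall>k'\<in>active i x. w i k' \<bullet> d \<le> w i k \<bullet> d}" by auto
        have "g \<bullet> x \<le> g \<bullet> (x + t *\<^sub>R d)"
          using d J m am t(2) by (intro min) (auto simp: subset_iff)
        then show ?thesis using t(1) by (simp add: inner_add_right zero_le_mult_iff)
      qed
      show ?thesis
      proof (cases "card ?E < DIM('a)")
        case True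
        \<comment> \<open>The zeros keep every tie of \<open>J\<close>; the value 1 at
          \<open>(m,k')\<close> means that the gap falls at rate 1.\<close>
        have "\<exists>d. \<forall>(i,l)\<in>insert (m,k') ?E. (w i l - w i (\<beta> i)) \<bullet> d = (\<lambda>s. if s = (m,k') then 1 else 0) (i,l)"
          using \<beta>K True E(2) mE mE' by (intro solvable) auto
        then obtain d where d: "\<forall>(i,l)\<in>insert (m,k') ?E. (w i l - w i (\<beta> i)) \<bullet> d = (if (i,l) = (m,k') then 1 else 0)"
          by blast
        have "(w i l - w i (\<beta> i)) \<bullet> d = 0" if "i \<in> J" "l \<in> active i x" for i l
          using d that mE by (cases "l = \<beta> i") (auto simp: ties_def)
        then have "w i l \<bullet> d = w i (\<beta> i) \<bullet> d" if "i \<in> J" "l \<in> active i x" for i l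
          using that by (simp add: inner_diff_left)
        then have "{l \<in> active i x. \<forall>l'\<in>active i x. w i l' \<bullet> d \<le> w i l \<bullet> d} = active i x" if "i \<in> J" for i
          using that by auto
        then have "0 \<le> g \<bullet> d" using x(1) by (intro local_min) simp
        moreover have "g \<bullet> d = -1" using d \<beta>m by (auto simp: g_def inner_diff_left)
        ultimately show ?thesis by simp
      next
        case False
        then have cardE: "card ?E = DIM('a)" using E(3) by simp
        \<comment> \<open>A unit with \<open>c\<close> active pieces contributes
          \<open>c - 1\<close> ties, and there are \<open>DIM('a)\<close> ties in fewer than
          \<open>DIM('a)\<close> units.\<close>
        have "\<exists>i\<in>J. 3 \<le> card (active i x)"
        proof (rule ccontr)
          assume "\<not> ?thesis"
          then have "(\<Sum>i\<in>J. card (active i x) - 1) \<le> (\<Sum>i\<in>J. 1)" by (intro sum_mono) force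
          then show False using cardE cardJ card_ties[OF J \<beta>] by simp
        qed
        then obtain i0 where i0: "i0 \<in> J" "3 \<le> card (active i0 x)" by blast
        define T where "T = active i0 x - {\<beta> i0}"
        have finT: "finite T" using finite_active by (simp add: T_def)
        have TE: "(i0,l) \<in> ?E" if "l \<in> T" for l using that i0 by (auto simp: T_def ties_def)
        \<comment> \<open>These directions will lower piece \<open>l\<close> of unit
          \<open>i0\<close> relative to the base piece and preserve all other ties.\<close>
        have "\<exists>d. \<forall>(i,l')\<in>?E. (w i l' - w i (\<beta> i)) \<bullet> d = (\<lambda>s. if s = (i0,l) then -1 else 0) (i,l')" for l
          using \<beta>K E by (intro solvable) auto
        then have "\<exists>d. \<forall>i l'. (i,l') \<in> ?E \<longrightarrow> (w i l' - w i (\<beta> i)) \<bullet> d = (if (i,l') = (i0,l) then -1 else 0)" for l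
          by fast
        then obtain e where e: "\<And>l i l'. (i,l') \<in> ?E \<Longrightarrow>
            (w i l' - w i (\<beta> i)) \<bullet> e l = (if (i,l') = (i0,l) then -1 else 0)"
          by metis
        have diff_e: "(w i l' - w i (\<beta> i)) \<bullet> e l = (if i = i0 \<and> l' = l then -1 else 0)"
          if "i \<in> J" "l' \<in> active i x" "l \<in> T" for i l l'
          using e[of i l' l] that by (cases "l' = \<beta> i") (auto simp: ties_def T_def)
        \<comment> \<open>Lowering a single active piece of a unit with three active pieces keeps the unit tied.\<close>
        have tied: "2 \<le> card {l' \<in> active i x. \<forall>l''\<in>active i x. w i l'' \<bullet> d \<le> w i l' \<bullet> d}"
          if i: "i \<in> J" and l: "l \<in> active i0 x"
            and d: "\<And>l'. l' \<in> active i x \<Longrightarrow> w i l' \<bullet> d = C - (if i = i0 \<and> l' = l then 1 else 0)"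
          for i l d C
        proof (cases "i = i0")
          case True
          have "active i0 x - {l} \<subseteq> {l' \<in> active i x. \<forall>l''\<in>active i x. w i l'' \<bullet> d \<le> w i l' \<bullet> d}"
            using d True by auto
          then have "card (active i0 x - {l}) \<le> card {l' \<in> active i x. \<forall>l''\<in>active i x. w i l'' \<bullet> d \<le> w i l' \<bullet> d}"
            using finite_active by (intro card_mono) auto
          moreover have "card (active i0 x - {l}) = card (active i0 x) - 1"
            using l finite_active by simp
          ultimately show ?thesis using i0(2) by linarith
        next
          case False
          then have "{l' \<in> active i x. \<forall>l''\<in>active i x. w i l'' \<bullet> d \<le> w i l' \<bullet> d} = active i x"
            using d by auto
          then show ?thesis using x(1) i by simp
        qed
        have nonneg: "0 \<le> g \<bullet> e l" if l: "l \<in> T" for l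
        proof (rule local_min)
          fix i assume i: "i \<in> J"
          have "w i l' \<bullet> e l = w i (\<beta> i) \<bullet> e l - (if i = i0 \<and> l' = l then 1 else 0)"
            if "l' \<in> active i x" for l'
            using diff_e[OF i that l] by (auto simp: inner_diff_left)
          then show "2 \<le> card {l' \<in> active i x. \<forall>l''\<in>active i x. w i l'' \<bullet> e l \<le> w i l' \<bullet> e l}"
            using l by (intro tied[OF i, of l]) (auto simp: T_def)
        qed
        \<comment> \<open>The negated sum raises all pieces in \<open>T\<close> equally above the
          base piece, so it amounts to lowering \<open>\<beta> i0\<close> alone. Together with
          \<open>nonneg\<close> this forces every \<open>g \<bullet> e l\<close> to vanish.\<close>
        have "0 \<le> g \<bullet> (- (\<Sum>l\<in>T. e l))"
        proof (rule local_min)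
          fix i assume i: "i \<in> J"
          let ?d = "- (\<Sum>l\<in>T. e l)"
          have "w i l' \<bullet> ?d = (w i (\<beta> i) \<bullet> ?d + (if i = i0 then 1 else 0)) - (if i = i0 \<and> l' = \<beta> i0 then 1 else 0)"
            if l': "l' \<in> active i x" for l'
          proof -
            have "(w i l' - w i (\<beta> i)) \<bullet> ?d = - (\<Sum>l\<in>T. (w i l' - w i (\<beta> i)) \<bullet> e l)"
              by (simp add: inner_sum_right)
            also have "\<dots> = - (\<Sum>l\<in>T. if i = i0 \<and> l' = l then -1 else 0)"
              using diff_e[OF i l'] by (simp cong: sum.cong)
            also have "\<dots> = (if i = i0 \<and> l' \<in> T then 1 else 0)"
              using finT by (cases "i = i0") (auto simp: sum.delta)
            finally show ?thesis using l' by (auto simp: inner_diff_left T_def)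
          qed
          then show "2 \<le> card {l' \<in> active i x. \<forall>l''\<in>active i x. w i l'' \<bullet> ?d \<le> w i l' \<bullet> ?d}"
            by (rule tied[OF i \<beta>])
        qed
        then have "(\<Sum>l\<in>T. g \<bullet> e l) \<le> 0" by (simp add: inner_sum_right)
        moreover have "0 \<le> (\<Sum>l\<in>T. g \<bullet> e l)" using nonneg by (rule sum_nonneg)
        ultimately have "(\<Sum>l\<in>T. g \<bullet> e l) = 0" by (rule antisym)
        then have zero: "g \<bullet> e l = 0" if "l \<in> T" for l
          using that sum_nonneg_eq_0_iff[OF finT, of "\<lambda>l. g \<bullet> e l"] nonneg by blast
        have "T \<noteq> {}"
        proof
          assume "T = {}"
          then have "active i0 x \<subseteq> {\<beta> i0}" by (auto simp: T_def)
          then have "card (active i0 x) \<le> card {\<beta> i0}" by (intro card_mono) auto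
          then show False using i0(2) by simp
        qed
        then obtain l where l: "l \<in> T" by auto
        \<comment> \<open>Exchange the only equation that \<open>e l\<close> fails for the equation
          of \<open>(m,k')\<close>, which it satisfies; the number of equations remains
          \<open>DIM('a)\<close>.\<close>
        let ?E' = "insert (m,k') (?E - {(i0,l)})"
        have "card ?E' = DIM('a)"
          using TE[OF l] E(2) mE cardE by (simp add: card_Suc_Diff1)
        moreover have "\<forall>(i,l')\<in>?E'. (w i l' - w i (\<beta> i)) \<bullet> e l = 0"
        proof -
          have "(w i l' - w i (\<beta> i)) \<bullet> e l = 0" if "(i,l') \<in> ?E - {(i0,l)}" for i l'
            using e[of i l' l] that by auto
          moreover have "(w m k' - w m (\<beta> m)) \<bullet> e l = 0"
            using zero[OF l] \<beta>m by (simp add: g_def inner_diff_left)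
          ultimately show ?thesis by blast
        qed
        ultimately have "e l = 0" using \<beta>K mE'[of "?E - {(i0,l)}"] by (intro unique[of \<beta> ?E']) auto
        then show ?thesis using e[OF TE[OF l], of l] by simp
      qed
    qed
  qed
qed

section \<open>Counting patterns and bounded patterns\<close>

definition patterns :: "(nat \<Rightarrow> nat) set" where
  "patterns = {p \<in> {..<N} \<rightarrow>\<^sub>E {..<K}. open_cell p \<noteq> {}}"

lemma finite_patterns: "finite patterns"
  by (rule finite_subset[of _ "{..<N} \<rightarrow>\<^sub>E {..<K}"]) (auto simp: patterns_def intro: finite_PiE)

lemma patternsI:
  assumes "\<And>i. i < N \<Longrightarrow> s i \<in> active i x" "\<And>i. \<not> i < N \<Longrightarrow> s i = undefined"
  shows "s \<in> patterns"
proof -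
  have "s i < K" if "i < N" for i using assms(1)[OF that] by (rule active_less)
  then show ?thesis
    using assms(2) open_cell_nonempty[OF assms(1)] by (auto simp: patterns_def PiE_iff extensional_def)
qed

lemma tied_choices:
  assumes "\<forall>i\<in>J. 2 \<le> card (active i x)"
  obtains p q where "\<And>i. p i \<in> active i x" "\<And>i. i \<in> J \<Longrightarrow> q i \<in> active i x \<and> q i \<noteq> p i"
proof -
  obtain p where p: "\<And>i. p i \<in> active i x" using active_choice[of x] by metis
  have "\<exists>q. q \<in> active i x \<and> q \<noteq> p i" if "i \<in> J" for i
  proof (rule ccontr)
    assume "\<not> ?thesis"
    then have "active i x \<subseteq> {p i}" by auto
    then have "card (active i x) \<le> card {p i}" by (intro card_mono) auto
    then show False using assms that by fastforce
  qed
  then show ?thesis using that p by metis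
qed

lemma card_patterns_ge: "(\<Sum>j\<le>DIM('a). N choose j) \<le> card patterns"
proof -
  have cube: "has_cube patterns J" if J: "J \<subseteq> {..<N}" "card J \<le> DIM('a)" for J
  proof -
    obtain x where x: "\<forall>i\<in>J. 2 \<le> card (active i x)" using crossing_exists[OF J] by blast
    obtain p q where pq: "\<And>i. p i \<in> active i x" "\<And>i. i \<in> J \<Longrightarrow> q i \<in> active i x \<and> q i \<noteq> p i"
      using tied_choices[OF x] by metis
    \<comment> \<open>The corners of the cube must be extensional to be patterns. Only the base
      point needs restricting, since \<open>q\<close> is used on subsets of \<open>J\<close>
      alone.\<close>
    let ?p = "restrict p {..<N}"
    have "(\<lambda>i. if i \<in> A then q i else ?p i) \<in> patterns" if "A \<subseteq> J" for A
      using that J(1) pq by (intro patternsI[of _ x]) auto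
    moreover have "\<forall>i\<in>J. ?p i \<noteq> q i" using J(1) pq(2) by fastforce
    ultimately show ?thesis unfolding has_cube_def by blast
  qed
  have "(\<Sum>j\<le>DIM('a). N choose j) = card {J. J \<subseteq> {..<N} \<and> card J \<le> DIM('a)}"
    by (simp add: card_subsets_le)
  also have "\<dots> \<le> card {J. J \<subseteq> {..<N} \<and> has_cube patterns J}"
    using cube by (intro card_mono) auto
  also have "\<dots> \<le> card patterns" using finite_patterns by (intro card_cubes_le) auto
  finally show ?thesis .
qed

text \<open>One more tied unit would produce \<open>Suc DIM('a)\<close> ties. This is what recovers
  \<open>J\<close> from a crossing point.\<close>

lemma tied_units_eq:
  assumes J: "J \<subseteq> {..<N}" "card J = DIM('a)" and x: "\<forall>i\<in>J. 2 \<le> card (active i x)"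
  shows "{i. i < N \<and> 2 \<le> card (active i x)} = J"
proof (rule ccontr)
  assume "\<not> ?thesis"
  then obtain j where j: "j < N" "2 \<le> card (active j x)" "j \<notin> J" using x J by blast
  have finJ: "finite J" using J finite_subset by blast
  obtain \<beta> where \<beta>: "\<And>i. \<beta> i \<in> active i x" using active_choice[of x] by metis
  have "Suc DIM('a) = (\<Sum>i\<in>insert j J. 1)" using J j finJ by simp
  also have "\<dots> \<le> (\<Sum>i\<in>insert j J. card (active i x) - 1)"
    using x j by (intro sum_mono) (auto dest: bspec)
  also have "\<dots> = card (ties \<beta> (insert j J) x)" using J j \<beta> by (intro card_ties[symmetric]) auto
  also have "\<dots> \<le> DIM('a)" using J j \<beta> by (intro card_ties_le) auto
  finally show False by simp
qed

text \<open>Making the competing piece a function of the active one lets the gap depend on the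
  pattern only, so two crossings with the same pattern are compared by the same functional.\<close>

definition other :: "nat \<Rightarrow> nat" where
  "other k = (if k = 0 then 1 else 0)"

text \<open>A cell with apex \<open>x\<close> on which the gap between the active piece of unit \<open>0\<close> and another
  piece is maximal at \<open>x\<close> is bounded, because this gap is nonnegative on the cell.\<close>

lemma bounded_cell_at_crossing:
  assumes J: "J \<subseteq> {1..<N}" "card J = DIM('a)" and N: "0 < N" and x: "\<forall>i\<in>J. 2 \<le> card (active i x)"
  shows "\<exists>s\<in>patterns. bounded (closed_cell s) \<and> x \<in> closed_cell s \<and>
     (\<forall>y\<in>closed_cell s. y \<noteq> x \<longrightarrow>
        (w 0 (s 0) - w 0 (other (s 0))) \<bullet> y < (w 0 (s 0) - w 0 (other (s 0))) \<bullet> x)"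
proof -
  have finJ: "finite J" using J finite_subset by blast
  have JN: "J \<subseteq> {..<N}" "0 \<notin> J" using J by auto
  obtain p q where p: "\<And>i. p i \<in> active i x" and q: "\<And>i. i \<in> J \<Longrightarrow> q i \<in> active i x \<and> q i \<noteq> p i"
    using tied_choices[OF x] by metis
  define v where "v i = w i (q i) - w i (p i)" for i
  define g where "g = w 0 (p 0) - w 0 (other (p 0))"
  have pK: "p i < K" for i using p active_less by blast
  have qK: "q i < K" if "i \<in> J" for i using q[OF that] active_less by blast
  have oth: "other (p 0) < K" "other (p 0) \<noteq> p 0" using K_ge_2 by (auto simp: other_def)
  let ?E = "(\<lambda>i. (i, q i)) ` J"
  have E: "?E \<subseteq> {(i,k). i < N \<and> k < K \<and> k \<noteq> p i}" using JN qK q by auto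
  have cardE: "card ?E = DIM('a)" using J by (simp add: card_image inj_on_def)
  have v_unique: "z = 0" if "\<And>i. i \<in> J \<Longrightarrow> v i \<bullet> z = 0" for z
    using that pK E cardE by (intro unique[of p ?E]) (auto simp: v_def)
  have "\<exists>d. \<forall>(i,k)\<in>?E. (w i k - w i (p i)) \<bullet> d = (\<lambda>s. if fst s = j then 1 else 0) (i,k)" for j
    using pK E cardE by (intro solvable) auto
  then have "\<exists>d. \<forall>i\<in>J. v i \<bullet> d = (if i = j then 1 else 0)" for j by (auto simp: v_def)
  \<comment> \<open>The \<open>d j\<close> form the basis dual to the tie normals
    \<open>v i\<close>; \<open>\<mu>\<close> below lists the coordinates of \<open>g\<close> with
    respect to these normals.\<close>
  then obtain d where d: "\<And>i j. i \<in> J \<Longrightarrow> v i \<bullet> d j = (if i = j then 1 else 0)" by metis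
  have expand: "z = (\<Sum>j\<in>J. (v j \<bullet> z) *\<^sub>R d j)" for z
  proof -
    have "v i \<bullet> (z - (\<Sum>j\<in>J. (v j \<bullet> z) *\<^sub>R d j)) = 0" if "i \<in> J" for i
    proof -
      have "v i \<bullet> (\<Sum>j\<in>J. (v j \<bullet> z) *\<^sub>R d j) = (\<Sum>j\<in>J. if i = j then v j \<bullet> z else 0)"
        unfolding inner_sum_right by (rule sum.cong) (auto simp: d[OF that])
      then show ?thesis using that finJ by (simp add: inner_diff_right)
    qed
    then show ?thesis using v_unique by force
  qed
  define \<mu> where "\<mu> j = g \<bullet> d j" for j
  have g_eq: "g \<bullet> z = (\<Sum>j\<in>J. (v j \<bullet> z) * \<mu> j)" for z
    by (subst expand[of z]) (simp add: inner_sum_right \<mu>_def)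
  \<comment> \<open>If \<open>\<mu> j\<close> vanished, \<open>d j\<close> would be orthogonal to
    the other tie normals and to \<open>g\<close>, that is, to \<open>DIM('a)\<close> rows in
    general position.\<close>
  have \<mu>0: "\<mu> j \<noteq> 0" if j: "j \<in> J" for j
  proof
    assume 0: "\<mu> j = 0"
    let ?E' = "insert (0, other (p 0)) ((\<lambda>i. (i, q i)) ` (J - {j}))"
    have "card ?E' = DIM('a)"
      using j J JN finJ by (auto simp: card_image inj_on_def card_insert_if card_Suc_Diff1)
    moreover have "?E' \<subseteq> {(i,k). i < N \<and> k < K \<and> k \<noteq> p i}" using E N oth by auto
    moreover have "\<forall>(i,k)\<in>?E'. (w i k - w i (p i)) \<bullet> d j = 0"
    proof -
      have "(w i (q i) - w i (p i)) \<bullet> d j = 0" if "i \<in> J - {j}" for i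
        using d[of i j] that by (simp add: v_def)
      moreover have "(w 0 (other (p 0)) - w 0 (p 0)) \<bullet> d j = 0"
        using 0 by (simp add: \<mu>_def g_def inner_diff_left)
      ultimately show ?thesis by auto
    qed
    ultimately have "d j = 0" using pK by (intro unique[of p ?E']) auto
    then show False using d[OF j, of j] by simp
  qed
  \<comment> \<open>The sign of \<open>\<mu> i\<close> decides on which side of the tie of unit
    \<open>i\<close> the cell lies: always the side on which \<open>g\<close> decreases away from
    \<open>x\<close>.\<close>
  define s where "s = (\<lambda>i. if i \<in> J \<and> \<mu> i < 0 then q i else if i < N then p i else undefined)"
  have s_active: "s i \<in> active i x" if "i < N" for i using that p q by (auto simp: s_def)
  have s_pat: "s \<in> patterns" using s_active JN by (intro patternsI[of s x]) (auto simp: s_def)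
  have s0: "s 0 = p 0" using JN N by (simp add: s_def)
  have sign: "(v i \<bullet> (y - x)) * \<mu> i = - (\<bar>\<mu> i\<bar> * \<bar>v i \<bullet> (y - x)\<bar>)"
    if y: "y \<in> closed_cell s" and i: "i \<in> J" for y i
  proof -
    have v_eq: "v i \<bullet> (y - x) = piece i (q i) y - piece i (p i) y"
      using piece_eq_of_active[of "q i" i x "p i"] p q[OF i]
      by (simp add: v_def piece_def inner_diff_left inner_diff_right)
    have act: "s i \<in> active i y" using y i JN by (auto simp: closed_cell_def)
    show ?thesis
    proof (cases "\<mu> i < 0")
      case True
      then have "piece i (p i) y \<le> piece i (q i) y" using act i pK by (auto simp: s_def active_def)
      then show ?thesis using v_eq True by simp
    next
      case False
      then have "piece i (q i) y \<le> piece i (p i) y"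
        using act i qK JN by (auto simp: s_def active_def)
      then have "v i \<bullet> (y - x) \<le> 0" using v_eq by simp
      then show ?thesis using False by simp
    qed
  qed
  have gap: "g \<bullet> (y - x) = - (\<Sum>i\<in>J. \<bar>\<mu> i\<bar> * \<bar>v i \<bullet> (y - x)\<bar>)" if y: "y \<in> closed_cell s" for y
    unfolding g_eq using sign[OF y] by (simp add: sum_negf cong: sum.cong)
  have strict: "g \<bullet> y < g \<bullet> x" if y: "y \<in> closed_cell s" "y \<noteq> x" for y
  proof -
    obtain i where i: "i \<in> J" "v i \<bullet> (y - x) \<noteq> 0" using v_unique[of "y - x"] y(2) by auto
    have "0 < (\<Sum>i\<in>J. \<bar>\<mu> i\<bar> * \<bar>v i \<bullet> (y - x)\<bar>)"
      using i \<mu>0 finJ by (intro sum_pos2[of J i]) auto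
    then show ?thesis using gap[OF y(1)] by (simp add: inner_diff_right)
  qed
  \<comment> \<open>\<open>C\<close> is the gap at \<open>x\<close>. The gap at \<open>y\<close> is
    nonnegative, so moving from \<open>x\<close> to \<open>y\<close> can use up at most
    \<open>C\<close>.\<close>
  define C where "C = g \<bullet> x + b 0 (p 0) - b 0 (other (p 0))"
  have "norm y \<le> norm x + (\<Sum>i\<in>J. C / \<bar>\<mu> i\<bar> * norm (d i))" if y: "y \<in> closed_cell s" for y
  proof -
    have "p 0 \<in> active 0 y" using y N s0 by (auto simp: closed_cell_def)
    then have "piece 0 (other (p 0)) y \<le> piece 0 (p 0) y" using oth by (auto simp: active_def)
    then have "- (g \<bullet> (y - x)) \<le> C" by (simp add: piece_def g_def C_def inner_diff_left inner_diff_right)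
    then have sum_le: "(\<Sum>i\<in>J. \<bar>\<mu> i\<bar> * \<bar>v i \<bullet> (y - x)\<bar>) \<le> C" using gap[OF y] by simp
    have v_le: "\<bar>v i \<bullet> (y - x)\<bar> \<le> C / \<bar>\<mu> i\<bar>" if i: "i \<in> J" for i
    proof -
      have "\<bar>\<mu> i\<bar> * \<bar>v i \<bullet> (y - x)\<bar> \<le> (\<Sum>i\<in>J. \<bar>\<mu> i\<bar> * \<bar>v i \<bullet> (y - x)\<bar>)"
        using i finJ by (intro member_le_sum) auto
      then show ?thesis using sum_le \<mu>0[OF i] by (simp add: pos_le_divide_eq mult.commute)
    qed
    have "norm (y - x) \<le> (\<Sum>i\<in>J. norm ((v i \<bullet> (y - x)) *\<^sub>R d i))"
      by (subst expand[of "y - x"]) (rule norm_sum)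
    also have "\<dots> \<le> (\<Sum>i\<in>J. C / \<bar>\<mu> i\<bar> * norm (d i))"
      unfolding norm_scaleR using v_le by (intro sum_mono mult_right_mono) auto
    finally show ?thesis using norm_triangle_sub[of y x] by linarith
  qed
  then have "bounded (closed_cell s)" by (auto simp: bounded_iff)
  moreover have "x \<in> closed_cell s" using s_active by (simp add: closed_cell_def)
  ultimately show ?thesis using s_pat strict s0 by (auto simp: g_def intro!: bexI[of _ s])
qed

text \<open>The map from \<open>J\<close> to the bounded cell at its crossing is injective: the cell
  determines its apex as the only maximiser of the gap, and the apex determines \<open>J\<close> as
  the set of its tied units.\<close>

lemma card_bounded_patterns_ge:
  "(N - 1) choose DIM('a) \<le> card {p \<in> patterns. bounded (closed_cell p)}"
proof (cases "N = 0")
  case False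
  let ?JJ = "{J. J \<subseteq> {1..<N} \<and> card J = DIM('a)}"
  have "\<exists>x. \<forall>i\<in>J. 2 \<le> card (active i x)" if "J \<in> ?JJ" for J
    using that by (intro crossing_exists) auto
  then obtain X where X: "\<And>J. J \<in> ?JJ \<Longrightarrow> \<forall>i\<in>J. 2 \<le> card (active i (X J))" by metis
  let ?g = "\<lambda>s. w 0 (s 0) - w 0 (other (s 0))"
  define T where "T x = {i. i < N \<and> 2 \<le> card (active i x)}" for x
  define apex where "apex J s \<longleftrightarrow> s \<in> patterns \<and> bounded (closed_cell s) \<and> X J \<in> closed_cell s \<and>
     (\<forall>y\<in>closed_cell s. y \<noteq> X J \<longrightarrow> ?g s \<bullet> y < ?g s \<bullet> X J)" for J s
  have "\<exists>s. apex J s" if "J \<in> ?JJ" for J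
    using bounded_cell_at_crossing[of J "X J"] that False X[OF that] by (auto simp: apex_def)
  then obtain s where "\<And>J. J \<in> ?JJ \<Longrightarrow> apex J (s J)" by metis
  note s = this[unfolded apex_def]
  have "inj_on s ?JJ"
  proof (rule inj_onI)
    fix J J' assume J: "J \<in> ?JJ" "J' \<in> ?JJ" and eq: "s J = s J'"
    have "X J = X J'"
    proof (rule ccontr)
      assume "X J \<noteq> X J'"
      then have "?g (s J) \<bullet> X J' < ?g (s J) \<bullet> X J" "?g (s J) \<bullet> X J < ?g (s J) \<bullet> X J'"
        using s[OF J(1)] s[OF J(2)] eq by auto
      then show False by simp
    qed
    moreover have "T (X L) = L" if "L \<in> ?JJ" for L
      unfolding T_def using that X[OF that] by (intro tied_units_eq) auto
    ultimately show "J = J'" using J by metis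
  qed
  moreover have "s ` ?JJ \<subseteq> {p \<in> patterns. bounded (closed_cell p)}" using s by auto
  ultimately have "card ?JJ \<le> card {p \<in> patterns. bounded (closed_cell p)}"
    using finite_patterns by (intro card_inj_on_le) auto
  then show ?thesis using n_subsets[of "{1..<N}" "DIM('a)"] by simp
next
  case True
  \<comment> \<open>Truncated subtraction gives \<open>0 - 1 = 0\<close>, and the dimension is
    positive.\<close>
  then have "(N - 1) choose DIM('a) = 0" by (simp add: binomial_eq_0)
  then show ?thesis by linarith
qed

end

subsection \<open>Zero sets of polynomials\<close>

text \<open>Polynomial in each variable separately, which is all the Fubini induction below needs.\<close>

definition poly_fun :: "'i set \<Rightarrow> (('i \<Rightarrow> real) \<Rightarrow> real) \<Rightarrow> bool" where
  "poly_fun I f \<longleftrightarrow> f \<in> borel_measurable (Pi\<^sub>M I (\<lambda>_. lborel)) \<and>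
     (\<forall>\<theta> i. \<exists>p. \<forall>t. f (\<theta>(i := t)) = poly p t)"

lemma poly_fun_const: "poly_fun I (\<lambda>_. c)"
  unfolding poly_fun_def by (auto intro!: exI[of _ "[:c:]"])

lemma poly_fun_component:
  assumes "j \<in> I"
  shows "poly_fun I (\<lambda>\<theta>. \<theta> j)"
  unfolding poly_fun_def
proof (intro conjI allI)
  show "(\<lambda>\<theta> :: 'a \<Rightarrow> real. \<theta> j) \<in> borel_measurable (Pi\<^sub>M I (\<lambda>_. lborel))"
    using measurable_component_singleton[OF assms, of "\<lambda>_. lborel :: real measure"] by simp
  show "\<exists>p. \<forall>t. (\<theta>(i := t)) j = poly p t" for \<theta> :: "'a \<Rightarrow> real" and i
  proof (cases "i = j")
    case True
    then show ?thesis by (intro exI[of _ "[:0, 1:]"]) simp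
  next
    case False
    then show ?thesis by (intro exI[of _ "[:\<theta> j:]"]) simp
  qed
qed

lemma poly_fun_add: "poly_fun I f \<Longrightarrow> poly_fun I g \<Longrightarrow> poly_fun I (\<lambda>\<theta>. f \<theta> + g \<theta>)"
  unfolding poly_fun_def
proof (elim conjE, intro conjI allI)
  fix \<theta> i assume "\<forall>\<theta> i. \<exists>p. \<forall>t. f (\<theta>(i := t)) = poly p t" "\<forall>\<theta> i. \<exists>p. \<forall>t. g (\<theta>(i := t)) = poly p t"
  then obtain p q where "\<forall>t. f (\<theta>(i := t)) = poly p t" "\<forall>t. g (\<theta>(i := t)) = poly q t" by blast
  then show "\<exists>p. \<forall>t. f (\<theta>(i := t)) + g (\<theta>(i := t)) = poly p t" by (intro exI[of _ "p + q"]) simp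
qed (rule borel_measurable_add)

lemma poly_fun_mult: "poly_fun I f \<Longrightarrow> poly_fun I g \<Longrightarrow> poly_fun I (\<lambda>\<theta>. f \<theta> * g \<theta>)"
  unfolding poly_fun_def
proof (elim conjE, intro conjI allI)
  fix \<theta> i assume "\<forall>\<theta> i. \<exists>p. \<forall>t. f (\<theta>(i := t)) = poly p t" "\<forall>\<theta> i. \<exists>p. \<forall>t. g (\<theta>(i := t)) = poly p t"
  then obtain p q where "\<forall>t. f (\<theta>(i := t)) = poly p t" "\<forall>t. g (\<theta>(i := t)) = poly q t" by blast
  then show "\<exists>p. \<forall>t. f (\<theta>(i := t)) * g (\<theta>(i := t)) = poly p t" by (intro exI[of _ "p * q"]) simp
qed (rule borel_measurable_times)

lemma poly_fun_diff: "poly_fun I f \<Longrightarrow> poly_fun I g \<Longrightarrow> poly_fun I (\<lambda>\<theta>. f \<theta> - g \<theta>)"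
  unfolding poly_fun_def
proof (elim conjE, intro conjI allI)
  fix \<theta> i assume "\<forall>\<theta> i. \<exists>p. \<forall>t. f (\<theta>(i := t)) = poly p t" "\<forall>\<theta> i. \<exists>p. \<forall>t. g (\<theta>(i := t)) = poly p t"
  then obtain p q where "\<forall>t. f (\<theta>(i := t)) = poly p t" "\<forall>t. g (\<theta>(i := t)) = poly q t" by blast
  then show "\<exists>p. \<forall>t. f (\<theta>(i := t)) - g (\<theta>(i := t)) = poly p t" by (intro exI[of _ "p - q"]) simp
qed (rule borel_measurable_diff)

lemma poly_fun_sum: "(\<And>s. s \<in> S \<Longrightarrow> poly_fun I (f s)) \<Longrightarrow> poly_fun I (\<lambda>\<theta>. \<Sum>s\<in>S. f s \<theta>)"
  by (induction S rule: infinite_finite_induct) (auto intro: poly_fun_const poly_fun_add)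

lemma poly_fun_prod: "(\<And>s. s \<in> S \<Longrightarrow> poly_fun I (f s)) \<Longrightarrow> poly_fun I (\<lambda>\<theta>. \<Prod>s\<in>S. f s \<theta>)"
  by (induction S rule: infinite_finite_induct) (auto intro: poly_fun_const poly_fun_mult)

lemmas poly_fun_intros =
  poly_fun_const poly_fun_component poly_fun_add poly_fun_mult poly_fun_diff poly_fun_sum poly_fun_prod

lemma AE_poly_fun_nonzero:
  assumes "finite I" "poly_fun I f" "\<theta>\<^sub>0 \<in> extensional I" "f \<theta>\<^sub>0 \<noteq> 0"
  shows "AE \<theta> in Pi\<^sub>M I (\<lambda>_. lborel). f \<theta> \<noteq> 0"
  using assms
proof (induction I arbitrary: f \<theta>\<^sub>0 rule: finite_induct)
  case empty
  then have "f (\<lambda>_. undefined) \<noteq> 0" by simp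
  then show ?case by (intro AE_I2) (auto simp: space_PiM)
next
  case (insert i I)
  interpret product_sigma_finite "\<lambda>_. lborel :: real measure" by standard
  let ?M = "Pi\<^sub>M (insert i I) (\<lambda>_. lborel :: real measure)"
  define g where "g x = f (x(i := \<theta>\<^sub>0 i))" for x
  have f_meas: "f \<in> borel_measurable ?M" using insert.prems by (simp add: poly_fun_def)
  have "(\<lambda>x. x(i := \<theta>\<^sub>0 i)) \<in> measurable (Pi\<^sub>M I (\<lambda>_. lborel)) ?M"
    by (rule measurable_fun_upd[where J = I]) auto
  then have "g \<in> borel_measurable (Pi\<^sub>M I (\<lambda>_. lborel))"
    unfolding g_def using f_meas by (rule measurable_compose)
  moreover have "\<exists>p. \<forall>t. g (x(j := t)) = poly p t" for x j
  proof (cases "j = i")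
    case True
    then show ?thesis by (auto simp: g_def intro!: exI[of _ "[:f (x(i := \<theta>\<^sub>0 i)):]"])
  next
    case False
    then have "g (x(j := t)) = f ((x(i := \<theta>\<^sub>0 i))(j := t))" for t by (simp add: g_def fun_upd_twist)
    then show ?thesis using insert.prems(1) by (simp add: poly_fun_def)
  qed
  ultimately have "poly_fun I g" by (auto simp: poly_fun_def)
  \<comment> \<open>The witness for \<open>g\<close> must forget coordinate \<open>i\<close> to lie
    in the smaller product; \<open>g\<close> puts the old value back.\<close>
  moreover have "\<theta>\<^sub>0(i := undefined) \<in> extensional I" using insert.prems(2) by (auto simp: extensional_def)
  moreover have "g (\<theta>\<^sub>0(i := undefined)) \<noteq> 0" using insert.prems(3) by (simp add: g_def)
  ultimately have AE_g: "AE x in Pi\<^sub>M I (\<lambda>_. lborel). g x \<noteq> 0" by (rule insert.IH)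
  define Z where "Z = {\<theta> \<in> space ?M. f \<theta> = 0}"
  have Z: "Z \<in> sets ?M" unfolding Z_def using f_meas by measurable
  have inner: "(\<integral>\<^sup>+t. indicator Z (x(i := t)) \<partial>lborel) = 0" if "g x \<noteq> 0" for x
  proof -
    obtain p where p: "\<And>t. f (x(i := t)) = poly p t"
      using insert.prems(1) unfolding poly_fun_def by metis
    have "p \<noteq> 0" using that p[of "\<theta>\<^sub>0 i"] by (auto simp: g_def)
    then have "finite {t. poly p t = 0}" by (rule poly_roots_finite)
    then have "AE t in lborel. t \<notin> {t. poly p t = 0}"
      by (intro AE_not_in finite_imp_null_set_lborel)
    then have "AE t in lborel. indicator Z (x(i := t)) = (0 :: ennreal)"
      by eventually_elim (use p in \<open>auto simp: Z_def indicator_def\<close>)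
    then have "(\<integral>\<^sup>+t. indicator Z (x(i := t)) \<partial>lborel) = (\<integral>\<^sup>+t. 0 \<partial>(lborel :: real measure))"
      by (rule nn_integral_cong_AE)
    then show ?thesis by simp
  qed
  have "emeasure ?M Z = (\<integral>\<^sup>+\<theta>. indicator Z \<theta> \<partial>?M)" using Z by simp
  also have "\<dots> = (\<integral>\<^sup>+x. \<integral>\<^sup>+t. indicator Z (x(i := t)) \<partial>lborel \<partial>Pi\<^sub>M I (\<lambda>_. lborel))"
    using Z insert.hyps by (intro product_nn_integral_insert) auto
  also have "\<dots> = (\<integral>\<^sup>+x. 0 \<partial>Pi\<^sub>M I (\<lambda>_. lborel :: real measure))"
    using AE_g by (intro nn_integral_cong_AE) (auto elim!: eventually_mono simp: inner)
  finally have "Z \<in> null_sets ?M" using Z by (simp add: null_sets_def)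
  then show ?case by (rule AE_I') (auto simp: Z_def)
qed

text \<open>Placing each row \<open>s\<close> at position \<open>\<phi> s\<close> and filling up
  with unit rows gives a square matrix whose determinant is polynomial in the parameters and equals
  1 at the witness, where the matrix is the identity.\<close>

lemma AE_rows_independent:
  fixes V :: "('i \<Rightarrow> real) \<Rightarrow> 's \<Rightarrow> real^'k"
  assumes I: "finite I" and V: "\<And>s j. s \<in> E \<Longrightarrow> poly_fun I (\<lambda>\<theta>. V \<theta> s $ j)"
    and \<phi>: "inj_on \<phi> E" and \<theta>\<^sub>0: "\<theta>\<^sub>0 \<in> extensional I" "\<And>s. s \<in> E \<Longrightarrow> V \<theta>\<^sub>0 s = axis (\<phi> s) 1"
  shows "AE \<theta> in Pi\<^sub>M I (\<lambda>_. lborel).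
     (\<forall>c. \<exists>d. \<forall>s\<in>E. V \<theta> s \<bullet> d = c s) \<and>
     (card E = CARD('k) \<longrightarrow> (\<forall>d. (\<forall>s\<in>E. V \<theta> s \<bullet> d = 0) \<longrightarrow> d = 0))"
proof -
  define M :: "('i \<Rightarrow> real) \<Rightarrow> real^'k^'k" where
    "M \<theta> = (\<chi> r. if r \<in> \<phi> ` E then V \<theta> (inv_into E \<phi> r) else axis r 1)" for \<theta>
  have "poly_fun I (\<lambda>\<theta>. M \<theta> $ r $ j)" for r j
    by (cases "r \<in> \<phi> ` E") (auto simp: M_def intro: poly_fun_const V inv_into_into)
  then have "poly_fun I (\<lambda>\<theta>. det (M \<theta>))"
    unfolding det_def by (intro poly_fun_intros)
  moreover have "M \<theta>\<^sub>0 = mat 1"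
    using \<theta>\<^sub>0(2) \<phi> by (auto simp: M_def mat_def axis_def vec_eq_iff inv_into_into f_inv_into_f)
  then have "det (M \<theta>\<^sub>0) \<noteq> 0" by simp
  ultimately have "AE \<theta> in Pi\<^sub>M I (\<lambda>_. lborel). det (M \<theta>) \<noteq> 0"
    using AE_poly_fun_nonzero[OF I _ \<theta>\<^sub>0(1)] by blast
  then show ?thesis
  proof eventually_elim
    case (elim \<theta>)
    have Mv: "(M \<theta> *v d) $ r = M \<theta> $ r \<bullet> d" for d r
      by (simp add: matrix_vector_mult_def inner_vec_def)
    have row: "M \<theta> $ \<phi> s = V \<theta> s" if "s \<in> E" for s using that \<phi> by (simp add: M_def)
    obtain M' where M': "M \<theta> ** M' = mat 1" "M' ** M \<theta> = mat 1"
      using elim by (metis invertible_def invertible_det_nz)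
    show ?case
    proof (intro conjI allI impI)
      fix c :: "'s \<Rightarrow> real"
      define y :: "real^'k" where "y = (\<chi> r. c (inv_into E \<phi> r))"
      have "M \<theta> *v (M' *v y) = y" by (simp add: matrix_vector_mul_assoc M')
      then have "V \<theta> s \<bullet> (M' *v y) = c s" if "s \<in> E" for s
        using Mv[of "M' *v y" "\<phi> s"] row[OF that] that \<phi> by (simp add: y_def)
      then show "\<exists>d. \<forall>s\<in>E. V \<theta> s \<bullet> d = c s" by blast
    next
      fix d assume card: "card E = CARD('k)" and d: "\<forall>s\<in>E. V \<theta> s \<bullet> d = 0"
      \<comment> \<open>No filling rows remain, so the hypothesis on \<open>d\<close> covers all
        rows of the matrix.\<close>
      have "\<phi> ` E = UNIV" using card \<phi> by (intro card_subset_eq) (auto simp: card_image)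
      have "(M \<theta> *v d) $ r = 0" for r
      proof -
        obtain s where "s \<in> E" "r = \<phi> s" using \<open>\<phi> ` E = UNIV\<close> by blast
        then show ?thesis using Mv[of d r] row d by simp
      qed
      then have "M \<theta> *v d = 0" by (simp add: vec_eq_iff)
      then have "M' *v (M \<theta> *v d) = 0" by simp
      then show "d = 0" by (simp add: matrix_vector_mul_assoc M')
    qed
  qed
qed

subsection \<open>Genericity of the first layer\<close>

lemma bij_betw_ix: "bij_betw (ix :: 'a::finite \<Rightarrow> nat) UNIV {..<CARD('a)}"
proof -
  have "\<exists>g :: 'a \<Rightarrow> nat. bij_betw g UNIV {..<CARD('a)}"
    using ex_bij_betw_finite_nat[of "UNIV :: 'a set"] by (simp add: atLeast0LessThan)
  then show ?thesis unfolding ix_def by (rule someI_ex)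
qed

lemma inj_ix: "inj ix"
  using bij_betw_ix by (rule bij_betw_imp_inj_on)

lemma ix_less: "ix (j :: 'a::finite) < CARD('a)"
  using bij_betw_ix by (auto simp: bij_betw_def)

lemma finite_maxout_params: "finite (maxout_params n0 ns K m)"
proof -
  define B where "B = n0 + sum_list ns"
  have w: "width n0 ns l \<le> B" if "l \<le> length ns" for l
  proof (cases l)
    case (Suc l')
    then have "ns ! l' \<le> sum_list ns" using that by (intro member_le_sum_list nth_mem) auto
    then show ?thesis using Suc by (simp add: width_def B_def)
  qed (simp add: width_def B_def)
  have "maxout_params n0 ns K m \<subseteq> {..Suc (length ns)} \<times> {..B + m} \<times> {..K} \<times> {..B}"
  proof (clarsimp simp: maxout_params_def)
    fix l i k j
    assume "Suc 0 \<le> l \<and> l \<le> length ns \<and> i < width n0 ns l \<and> k < K \<and> j \<le> width n0 ns (l - Suc 0)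
      \<or> l = Suc (length ns) \<and> i < m \<and> k = 0 \<and> j \<le> width n0 ns (length ns)"
    then show "l \<le> Suc (length ns) \<and> i \<le> B + m \<and> k \<le> K \<and> j \<le> B"
      using w[of l] w[of "l - Suc 0"] w[of "length ns"] by (auto simp: le_diff_conv intro: le_trans)
  qed
  then show ?thesis by (rule finite_subset) auto
qed

lemma hidden_paramI:
  "l < length ns \<Longrightarrow> i < width n0 ns (Suc l) \<Longrightarrow> k < K \<Longrightarrow> j \<le> width n0 ns l
    \<Longrightarrow> (Suc l, i, k, j) \<in> maxout_params n0 ns K m"
  by (simp add: maxout_params_def)

lemma output_paramI:
  "i < m \<Longrightarrow> j \<le> width n0 ns (length ns) \<Longrightarrow> (Suc (length ns), i, 0, j) \<in> maxout_params n0 ns K m"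
  by (simp add: maxout_params_def)

text \<open>The coordinates of a row are read off through \<open>code\<close>, so that \<open>ix\<close> gives the weights alone
  and its extension to the option type by \<open>CARD('n)\<close> appends the bias.\<close>

definition row_diff ::
  "('k::finite \<Rightarrow> nat) \<Rightarrow> (nat \<Rightarrow> nat) \<Rightarrow> (nat \<times> nat \<times> nat \<times> nat \<Rightarrow> real) \<Rightarrow> nat \<times> nat \<Rightarrow> real^'k" where
  "row_diff code \<beta> \<theta> s = (\<chi> j. \<theta> (1, fst s, snd s, code j) - \<theta> (1, fst s, \<beta> (fst s), code j))"

text \<open>The witness gives each piece in \<open>E\<close> a unit vector of its own and sets all
  other entries to 0. Base pieces are never in \<open>E\<close>, so the differences are these unit
  vectors.\<close>

lemma AE_first_layer_rows_independent:
  fixes code :: "'k::finite \<Rightarrow> nat"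
  assumes code: "inj code" "\<And>j. code j \<le> n0" and ns: "ns \<noteq> []"
    and \<beta>: "\<forall>i<hd ns. \<beta> i < K" and E: "E \<subseteq> {(i,k). i < hd ns \<and> k < K \<and> k \<noteq> \<beta> i}"
    and card: "card E \<le> CARD('k)"
  shows "AE \<theta> in Pi\<^sub>M (maxout_params n0 ns K m) (\<lambda>_. lborel).
     (\<forall>c. \<exists>d. \<forall>s\<in>E. row_diff code \<beta> \<theta> s \<bullet> d = c s) \<and>
     (card E = CARD('k) \<longrightarrow> (\<forall>d. (\<forall>s\<in>E. row_diff code \<beta> \<theta> s \<bullet> d = 0) \<longrightarrow> d = 0))"
proof -
  have w1: "width n0 ns (Suc 0) = hd ns" using ns by (simp add: width_def hd_conv_nth)
  have mem: "(1,i,k,code j) \<in> maxout_params n0 ns K m" if "i < hd ns" "k < K" for i k j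
    using hidden_paramI[of 0 ns i n0 k K "code j" m] that ns code(2)[of j] w1 by (simp add: width_def)
  have "E \<subseteq> {..<hd ns} \<times> {..<K}" using E by auto
  then have "finite E" by (rule finite_subset) simp
  then obtain \<phi> :: "nat \<times> nat \<Rightarrow> 'k" where \<phi>: "inj_on \<phi> E"
    using card_le_inj[of E "UNIV :: 'k set"] card by auto
  define \<theta>\<^sub>0 :: "nat \<times> nat \<times> nat \<times> nat \<Rightarrow> real" where
    "\<theta>\<^sub>0 = restrict (\<lambda>(l,i,k,j). if (i,k) \<in> E \<and> j = code (\<phi> (i,k)) then 1 else 0) (maxout_params n0 ns K m)"
  show ?thesis
  proof (rule AE_rows_independent[OF finite_maxout_params _ \<phi>])
    fix s j assume s: "s \<in> E"
    then obtain i k where ik: "s = (i,k)" "i < hd ns" "k < K" using E by auto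
    then show "poly_fun (maxout_params n0 ns K m) (\<lambda>\<theta>. row_diff code \<beta> \<theta> s $ j)"
      using \<beta> by (auto simp: row_diff_def intro!: poly_fun_diff poly_fun_component mem[simplified])
  next
    show "\<theta>\<^sub>0 \<in> extensional (maxout_params n0 ns K m)" by (simp add: \<theta>\<^sub>0_def)
  next
    fix s assume s: "s \<in> E"
    then obtain i k where ik: "s = (i,k)" "i < hd ns" "k < K" "k \<noteq> \<beta> i" using E by auto
    have "(i, \<beta> i) \<notin> E" using E by auto
    then show "row_diff code \<beta> \<theta>\<^sub>0 s = axis (\<phi> s) 1"
      using ik s mem[of i k] mem[of i "\<beta> i"] \<beta> code(1)
      by (auto simp: row_diff_def \<theta>\<^sub>0_def axis_def vec_eq_iff inj_eq)
  qed
qed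

definition first_weight :: "(nat \<times> nat \<times> nat \<times> nat \<Rightarrow> real) \<Rightarrow> nat \<Rightarrow> nat \<Rightarrow> real^'n" where
  "first_weight \<theta> i k = (\<chi> j. \<theta> (1,i,k,ix j))"

definition first_bias :: "nat \<Rightarrow> (nat \<times> nat \<times> nat \<times> nat \<Rightarrow> real) \<Rightarrow> nat \<Rightarrow> nat \<Rightarrow> real" where
  "first_bias n0 \<theta> i k = \<theta> (1,i,k,n0)"

text \<open>The locale conditions involve finitely many systems \<open>E\<close>. Two of them
  concern the weight rows alone. The third uses rows extended by the bias: an excess tie would put a
  nonzero vector into the kernel of a full square system of size
  \<open>CARD('n) + 1\<close>.\<close>

lemma AE_generic_arrangement:
  assumes K: "2 \<le> K" and ns: "ns \<noteq> []"
  shows "AE \<theta> in Pi\<^sub>M (maxout_params CARD('n) ns K m) (\<lambda>_. lborel).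
     generic_arrangement (first_weight \<theta> :: nat \<Rightarrow> nat \<Rightarrow> real^'n) (first_bias CARD('n) \<theta>) (hd ns) K"
proof -
  define N where "N = hd ns"
  let ?M = "Pi\<^sub>M (maxout_params CARD('n) ns K m) (\<lambda>_. lborel :: real measure)"
  define w where "w \<theta> = (first_weight \<theta> :: nat \<Rightarrow> nat \<Rightarrow> real^'n)" for \<theta>
  define b where "b = first_bias CARD('n)"
  define code :: "'n option \<Rightarrow> nat" where "code = case_option CARD('n) ix"
  define sys where "sys \<beta> = {E. E \<subseteq> {(i,k). i < N \<and> k < K \<and> k \<noteq> \<beta> i}}" for \<beta> :: "nat \<Rightarrow> nat"
  define good where "good \<theta> \<beta> E \<longleftrightarrow>
     (card E \<le> CARD('n) \<longrightarrow> (\<forall>c. \<exists>d :: real^'n. \<forall>s\<in>E. row_diff ix \<beta> \<theta> s \<bullet> d = c s)) \<and>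
     (card E = CARD('n) \<longrightarrow> (\<forall>d :: real^'n. (\<forall>s\<in>E. row_diff ix \<beta> \<theta> s \<bullet> d = 0) \<longrightarrow> d = 0)) \<and>
     (card E = CARD('n option) \<longrightarrow> (\<forall>d. (\<forall>s\<in>E. row_diff code \<beta> \<theta> s \<bullet> d = 0) \<longrightarrow> d = 0))" for \<theta> \<beta> E
  have V_eq: "row_diff ix \<beta> \<theta> (i,k) = w \<theta> i k - w \<theta> i (\<beta> i)" for \<beta> \<theta> i k
    by (simp add: row_diff_def w_def first_weight_def vec_eq_iff)
  have inj_code: "inj code"
    using inj_ix ix_less[where 'a='n] by (auto simp: code_def inj_def less_le split: option.splits) (metis less_irrefl)+
  have code_le: "code j \<le> CARD('n)" for j
    using ix_less[where 'a='n] by (auto simp: code_def less_imp_le split: option.splits)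
  have "AE \<theta> in ?M. good \<theta> \<beta> E" if \<beta>: "\<beta> \<in> {..<N} \<rightarrow>\<^sub>E {..<K}" and E: "E \<in> sys \<beta>" for \<beta> E
  proof -
    have \<beta>': "\<forall>i<hd ns. \<beta> i < K" using \<beta> by (auto simp: N_def)
    have E': "E \<subseteq> {(i,k). i < hd ns \<and> k < K \<and> k \<noteq> \<beta> i}" using E by (auto simp: sys_def N_def)
    have 1: "AE \<theta> in ?M. card E \<le> CARD('n) \<longrightarrow> (\<forall>c. \<exists>d :: real^'n. \<forall>s\<in>E. row_diff ix \<beta> \<theta> s \<bullet> d = c s) \<and>
     (card E = CARD('n) \<longrightarrow> (\<forall>d :: real^'n. (\<forall>s\<in>E. row_diff ix \<beta> \<theta> s \<bullet> d = 0) \<longrightarrow> d = 0))"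
    proof (cases "card E \<le> CARD('n)")
      case True
      from AE_first_layer_rows_independent[OF inj_ix less_imp_le[OF ix_less] ns \<beta>' E' True, of m]
      show ?thesis by (rule eventually_mono) simp
    qed simp
    have 2: "AE \<theta> in ?M. card E = CARD('n option) \<longrightarrow> (\<forall>d. (\<forall>s\<in>E. row_diff code \<beta> \<theta> s \<bullet> d = 0) \<longrightarrow> d = 0)"
    proof (cases "card E = CARD('n option)")
      case True
      then have "card E \<le> CARD('n option)" by simp
      from AE_first_layer_rows_independent[OF inj_code code_le ns \<beta>' E' this, of m]
      show ?thesis by (rule eventually_mono) (use True in simp)
    qed simp
    from 1 2 show ?thesis by eventually_elim (auto simp: good_def)
  qed
  moreover have "countable ({..<N} \<rightarrow>\<^sub>E {..<K})" by (intro countable_finite finite_PiE) auto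
  moreover have "countable (sys \<beta>)" for \<beta>
  proof -
    have "sys \<beta> \<subseteq> Pow ({..<N} \<times> {..<K})" by (auto simp: sys_def)
    then have "finite (sys \<beta>)" by (rule finite_subset) simp
    then show ?thesis by (rule countable_finite)
  qed
  ultimately have "AE \<theta> in ?M. \<forall>\<beta>\<in>{..<N} \<rightarrow>\<^sub>E {..<K}. \<forall>E\<in>sys \<beta>. good \<theta> \<beta> E"
    by (simp add: AE_ball_countable)
  then show ?thesis
  proof eventually_elim
    case (elim \<theta>)
    have good: "good \<theta> \<beta> E" if \<beta>: "\<And>i. i < N \<Longrightarrow> \<beta> i < K" and E: "E \<subseteq> {(i,k). i < N \<and> k < K \<and> k \<noteq> \<beta> i}" for \<beta> E
    proof -
      \<comment> \<open>Only extensional base choices were covered, as there are finitely many of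
        them; an arbitrary one matters only through its values below \<open>N\<close>.\<close>
      let ?\<beta> = "restrict \<beta> {..<N}"
      have "?\<beta> \<in> {..<N} \<rightarrow>\<^sub>E {..<K}" "E \<in> sys ?\<beta>" using \<beta> E by (auto simp: sys_def)
      then have "good \<theta> ?\<beta> E" using elim by blast
      moreover have "\<forall>s\<in>E. (row_diff ix ?\<beta> \<theta> s :: real^'n) = row_diff ix \<beta> \<theta> s \<and> row_diff code ?\<beta> \<theta> s = row_diff code \<beta> \<theta> s" using E by (auto simp: row_diff_def)
      ultimately show ?thesis by (simp add: good_def cong: ball_cong)
    qed
    have "generic_arrangement (w \<theta>) (b \<theta>) N K"
    proof
      show "2 \<le> K" by (rule K)
    next
      fix \<beta> E and c :: "nat \<times> nat \<Rightarrow> real"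
      assume "\<And>i. i < N \<Longrightarrow> \<beta> i < K" "E \<subseteq> {(i,k). i < N \<and> k < K \<and> k \<noteq> \<beta> i}" "card E \<le> DIM(real^'n)"
      then have "\<exists>d :: real^'n. \<forall>s\<in>E. row_diff ix \<beta> \<theta> s \<bullet> d = c s" using good[of \<beta> E] by (simp add: good_def)
      then show "\<exists>d. \<forall>(i,k)\<in>E. (w \<theta> i k - w \<theta> i (\<beta> i)) \<bullet> d = c (i,k)" using V_eq[of \<beta> \<theta>] by fastforce
    next
      fix \<beta> E and d :: "real^'n"
      assume *: "\<And>i. i < N \<Longrightarrow> \<beta> i < K" "E \<subseteq> {(i,k). i < N \<and> k < K \<and> k \<noteq> \<beta> i}" "card E = DIM(real^'n)"
        and d: "\<forall>(i,k)\<in>E. (w \<theta> i k - w \<theta> i (\<beta> i)) \<bullet> d = 0"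
      have "\<forall>s\<in>E. row_diff ix \<beta> \<theta> s \<bullet> d = 0" using d V_eq[of \<beta> \<theta>] by auto
      then show "d = 0" using good[of \<beta> E] * by (simp add: good_def)
    next
      fix \<beta> E and x :: "real^'n"
      assume *: "\<And>i. i < N \<Longrightarrow> \<beta> i < K" "E \<subseteq> {(i,k). i < N \<and> k < K \<and> k \<noteq> \<beta> i}" "card E = Suc DIM(real^'n)"
      show "\<exists>(i,k)\<in>E. w \<theta> i k \<bullet> x + b \<theta> i k \<noteq> w \<theta> i (\<beta> i) \<bullet> x + b \<theta> i (\<beta> i)"
      proof (rule ccontr)
        assume "\<not> ?thesis"
        then have eq: "w \<theta> i k \<bullet> x + b \<theta> i k = w \<theta> i (\<beta> i) \<bullet> x + b \<theta> i (\<beta> i)" if "(i,k) \<in> E" for i k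
          using that by blast
        \<comment> \<open>Homogeneous coordinates: the entry 1 multiplies the bias
          difference.\<close>
        define d :: "real^('n option)" where "d = (\<chi> j. case j of None \<Rightarrow> 1 | Some j \<Rightarrow> x $ j)"
        have V'_eq: "row_diff code \<beta> \<theta> (i,k) \<bullet> d = (w \<theta> i k - w \<theta> i (\<beta> i)) \<bullet> x + (b \<theta> i k - b \<theta> i (\<beta> i))" for i k
          by (simp add: row_diff_def d_def inner_vec_def UNIV_option_conv sum.reindex code_def w_def b_def
              first_weight_def first_bias_def)
        have "row_diff code \<beta> \<theta> (i,k) \<bullet> d = 0" if "(i,k) \<in> E" for i k
          using eq[OF that] by (simp add: V'_eq inner_diff_left)
        then have "\<forall>s\<in>E. row_diff code \<beta> \<theta> s \<bullet> d = 0" by auto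
        then have "d = 0" using good[of \<beta> E] * by (simp add: good_def card_UNIV_option)
        then have "d $ None = 0" by simp
        then show False by (simp add: d_def)
      qed
    qed
    then show ?case by (simp add: w_def b_def N_def)
  qed
qed

subsection \<open>Selections of affine pieces\<close>

definition input_coords :: "real^'n \<Rightarrow> nat \<Rightarrow> real" where
  "input_coords x = (\<lambda>j. if j < CARD('n) then x $ (inv_into UNIV (ix :: 'n \<Rightarrow> nat) j) else 0)"

text \<open>Replacing each maximum by a prescribed piece makes the network affine in the input and
  polynomial in the parameters.\<close>

fun selected_hidden ::
  "(nat \<times> nat \<times> nat \<times> nat \<Rightarrow> real) \<Rightarrow> nat \<Rightarrow> nat list \<Rightarrow> (nat \<times> nat \<Rightarrow> nat) \<Rightarrow> nat \<Rightarrow> (nat \<Rightarrow> real) \<Rightarrow> nat \<Rightarrow> real" where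
  "selected_hidden \<theta> n0 ns Q 0 x = x"
| "selected_hidden \<theta> n0 ns Q (Suc l) x = (\<lambda>i.
     (\<Sum>j<width n0 ns l. \<theta> (Suc l, i, Q (Suc l, i), j) * selected_hidden \<theta> n0 ns Q l x j)
       + \<theta> (Suc l, i, Q (Suc l, i), width n0 ns l))"

definition preact ::
  "(nat \<times> nat \<times> nat \<times> nat \<Rightarrow> real) \<Rightarrow> nat \<Rightarrow> nat \<Rightarrow> nat \<Rightarrow> nat \<Rightarrow> (nat \<Rightarrow> real) \<Rightarrow> real" where
  "preact \<theta> d l i k h = (\<Sum>j<d. \<theta> (l,i,k,j) * h j) + \<theta> (l,i,k,d)"

definition selected_net ::
  "(nat \<times> nat \<times> nat \<times> nat \<Rightarrow> real) \<Rightarrow> nat list \<Rightarrow> (nat \<times> nat \<Rightarrow> nat) \<Rightarrow> real^'n \<Rightarrow> real^'m" where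
  "selected_net \<theta> ns Q x = (\<chi> r. preact \<theta> (width CARD('n) ns (length ns)) (Suc (length ns)) (ix r) 0
     (selected_hidden \<theta> CARD('n) ns Q (length ns) (input_coords x)))"

definition selections :: "nat \<Rightarrow> nat list \<Rightarrow> nat \<Rightarrow> (nat \<times> nat \<Rightarrow> nat) set" where
  "selections n0 ns K = {(l,i). 1 \<le> l \<and> l \<le> length ns \<and> i < width n0 ns l} \<rightarrow>\<^sub>E {..<K}"

text \<open>Maximality of the chosen pieces is tested inside the selected network, not the true one,
  so all constraints are affine and the cell is a polyhedron.\<close>

definition selection_cell ::
  "(nat \<times> nat \<times> nat \<times> nat \<Rightarrow> real) \<Rightarrow> nat list \<Rightarrow> nat \<Rightarrow> (nat \<times> nat \<Rightarrow> nat) \<Rightarrow> (real^'n) set" where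
  "selection_cell \<theta> ns K Q = {x. \<forall>l<length ns. \<forall>i<width CARD('n) ns (Suc l). \<forall>k<K.
     preact \<theta> (width CARD('n) ns l) (Suc l) i k (selected_hidden \<theta> CARD('n) ns Q l (input_coords x))
       \<le> selected_hidden \<theta> CARD('n) ns Q (Suc l) (input_coords x) i}"

lemma selected_hidden_Suc:
  "selected_hidden \<theta> n0 ns Q (Suc l) x i
     = preact \<theta> (width n0 ns l) (Suc l) i (Q (Suc l, i)) (selected_hidden \<theta> n0 ns Q l x)"
  by (simp add: preact_def)

lemma preact_cong: "(\<And>j. j < d \<Longrightarrow> h j = h' j) \<Longrightarrow> preact \<theta> d l i k h = preact \<theta> d l i k h'"
  by (simp add: preact_def)

lemma maxout_unit_eq: "maxout_unit \<theta> K d l i h = Max ((\<lambda>k. preact \<theta> d l i k h) ` {..<K})"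
  by (simp add: maxout_unit_def preact_def)

lemma maxout_net_eq:
  "maxout_net \<theta> ns K (x :: real^'n) = (\<chi> r. preact \<theta> (width CARD('n) ns (length ns)) (Suc (length ns)) (ix r) 0
     (maxout_hidden \<theta> CARD('n) ns K (length ns) (input_coords x)))"
  by (simp add: maxout_net_def preact_def input_coords_def Let_def)

lemma selection_less:
  "Q \<in> selections n0 ns K \<Longrightarrow> l < length ns \<Longrightarrow> i < width n0 ns (Suc l) \<Longrightarrow> Q (Suc l, i) < K"
  by (auto simp: selections_def PiE_iff)

lemma finite_selections: "finite (selections n0 ns K)"
proof -
  have "{(l,i). 1 \<le> l \<and> l \<le> length ns \<and> i < width n0 ns l} \<subseteq> Sigma {..length ns} (\<lambda>l. {..<width n0 ns l})" by auto
  then have "finite {(l,i). 1 \<le> l \<and> l \<le> length ns \<and> i < width n0 ns l}" by (rule finite_subset) auto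
  then show ?thesis unfolding selections_def by (intro finite_PiE) auto
qed

lemma hidden_eq_selected:
  fixes x :: "real^'n"
  assumes Q: "Q \<in> selections CARD('n) ns K" and x: "x \<in> selection_cell \<theta> ns K Q"
    and "l \<le> length ns" "i < width CARD('n) ns l"
  shows "maxout_hidden \<theta> CARD('n) ns K l (input_coords x) i = selected_hidden \<theta> CARD('n) ns Q l (input_coords x) i"
  using assms(3,4)
proof (induction l arbitrary: i)
  case (Suc l)
  let ?s = "selected_hidden \<theta> CARD('n) ns Q l (input_coords x)"
  have "maxout_hidden \<theta> CARD('n) ns K (Suc l) (input_coords x) i
      = Max ((\<lambda>k. preact \<theta> (width CARD('n) ns l) (Suc l) i k (maxout_hidden \<theta> CARD('n) ns K l (input_coords x))) ` {..<K})"
    by (simp add: maxout_unit_eq)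
  also have "\<dots> = Max ((\<lambda>k. preact \<theta> (width CARD('n) ns l) (Suc l) i k ?s) ` {..<K})"
    using Suc by (intro arg_cong[of _ _ Max] image_cong preact_cong) auto
  also have "\<dots> = preact \<theta> (width CARD('n) ns l) (Suc l) i (Q (Suc l, i)) ?s"
  proof (rule Max_eqI)
    have "Q (Suc l, i) < K" using Suc.prems by (intro selection_less[OF Q]) auto
    then show "preact \<theta> (width CARD('n) ns l) (Suc l) i (Q (Suc l, i)) ?s
        \<in> (\<lambda>k. preact \<theta> (width CARD('n) ns l) (Suc l) i k ?s) ` {..<K}" by blast
    fix y assume "y \<in> (\<lambda>k. preact \<theta> (width CARD('n) ns l) (Suc l) i k ?s) ` {..<K}"
    then obtain k where k: "k < K" "y = preact \<theta> (width CARD('n) ns l) (Suc l) i k ?s" by blast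
    have "l < length ns" using Suc.prems by simp
    then show "y \<le> preact \<theta> (width CARD('n) ns l) (Suc l) i (Q (Suc l, i)) ?s"
      using x k Suc.prems(2) by (simp only: selection_cell_def mem_Collect_eq selected_hidden_Suc)
  qed simp
  finally show ?case by (simp only: selected_hidden_Suc)
qed simp

lemma net_eq_selected:
  fixes x :: "real^'n"
  assumes "Q \<in> selections CARD('n) ns K" "x \<in> selection_cell \<theta> ns K Q"
  shows "(maxout_net \<theta> ns K x :: real^'m) = selected_net \<theta> ns Q x"
  unfolding maxout_net_eq selected_net_def vec_eq_iff
  using hidden_eq_selected[OF assms order_refl] by (auto intro: preact_cong)

text \<open>Choose at each unit a piece that is maximal for the true network at \<open>x\<close>;
  layer by layer, the selected network then has the true values.\<close>

lemma selection_cells_cover: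
  fixes x :: "real^'n"
  assumes "0 < K"
  shows "\<exists>Q\<in>selections CARD('n) ns K. x \<in> selection_cell \<theta> ns K Q"
proof -
  define h where "h l = maxout_hidden \<theta> CARD('n) ns K l (input_coords x)" for l
  define P where "P l i k \<longleftrightarrow> k < K \<and> (\<forall>k'<K. preact \<theta> (width CARD('n) ns (l - 1)) l i k' (h (l - 1))
      \<le> preact \<theta> (width CARD('n) ns (l - 1)) l i k (h (l - 1)))" for l i k
  have "\<exists>k. P l i k" for l i
  proof -
    let ?f = "\<lambda>k. preact \<theta> (width CARD('n) ns (l - 1)) l i k (h (l - 1))"
    have "Max (?f ` {..<K}) \<in> ?f ` {..<K}" using assms by (intro Max_in) (auto simp: lessThan_empty_iff)
    then obtain k where k: "k < K" "Max (?f ` {..<K}) = ?f k" by blast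
    have "?f k' \<le> ?f k" if "k' < K" for k' unfolding k(2)[symmetric] using that by (intro Max_ge) auto
    then show ?thesis using k(1) by (auto simp: P_def)
  qed
  then obtain q where q: "\<And>l i. P l i (q l i)" by metis
  define Q where "Q = restrict (\<lambda>(l,i). q l i) {(l,i). 1 \<le> l \<and> l \<le> length ns \<and> i < width CARD('n) ns l}"
  have Q: "Q \<in> selections CARD('n) ns K" using q by (auto simp: Q_def selections_def P_def)
  have Qq: "Q (Suc l, i) = q (Suc l) i" if "l < length ns" "i < width CARD('n) ns (Suc l)" for l i
    using that by (simp add: Q_def)
  have eq: "selected_hidden \<theta> CARD('n) ns Q l (input_coords x) i = h l i"
    if "l \<le> length ns" "i < width CARD('n) ns l" for l i
    using that
  proof (induction l arbitrary: i)
    case 0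
    then show ?case by (simp add: h_def)
  next
    case (Suc l)
    have "selected_hidden \<theta> CARD('n) ns Q (Suc l) (input_coords x) i
        = preact \<theta> (width CARD('n) ns l) (Suc l) i (q (Suc l) i) (h l)"
      unfolding selected_hidden_Suc using Suc Qq[of l i] by (auto intro: preact_cong)
    also have "\<dots> = Max ((\<lambda>k. preact \<theta> (width CARD('n) ns l) (Suc l) i k (h l)) ` {..<K})"
      using q[of "Suc l" i] by (intro Max_eqI[symmetric]) (auto simp: P_def)
    also have "\<dots> = h (Suc l) i" by (simp add: h_def maxout_unit_eq)
    finally show ?case .
  qed
  have "x \<in> selection_cell \<theta> ns K Q"
    unfolding selection_cell_def mem_Collect_eq selected_hidden_Suc
  proof (intro allI impI)
    fix l i k assume l: "l < length ns" "i < width CARD('n) ns (Suc l)" "k < K"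
    have "preact \<theta> (width CARD('n) ns l) (Suc l) i k' (selected_hidden \<theta> CARD('n) ns Q l (input_coords x))
        = preact \<theta> (width CARD('n) ns l) (Suc l) i k' (h l)" for k'
      using eq l(1) by (intro preact_cong) auto
    then show "preact \<theta> (width CARD('n) ns l) (Suc l) i k (selected_hidden \<theta> CARD('n) ns Q l (input_coords x))
       \<le> preact \<theta> (width CARD('n) ns l) (Suc l) i (Q (Suc l, i)) (selected_hidden \<theta> CARD('n) ns Q l (input_coords x))"
      using q[of "Suc l" i] l Qq by (simp add: P_def)
  qed
  then show ?thesis using Q by blast
qed

section \<open>Affine dependence on the input\<close>

definition affine_fun :: "('a::real_inner \<Rightarrow> real) \<Rightarrow> bool" where
  "affine_fun f \<longleftrightarrow> (\<exists>g c. \<forall>x. f x = g \<bullet> x + c)"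

lemma affine_fun_const: "affine_fun (\<lambda>_. c)"
  unfolding affine_fun_def by (intro exI[of _ 0] exI[of _ c]) simp

lemma affine_fun_add:
  assumes "affine_fun f" "affine_fun g" shows "affine_fun (\<lambda>x. f x + g x)"
proof -
  obtain u c v d where "\<forall>x. f x = u \<bullet> x + c" "\<forall>x. g x = v \<bullet> x + d" using assms by (auto simp: affine_fun_def)
  then show ?thesis unfolding affine_fun_def
    by (intro exI[of _ "u + v"] exI[of _ "c + d"]) (simp add: inner_add_left)
qed

lemma affine_fun_mult:
  assumes "affine_fun f" shows "affine_fun (\<lambda>x. a * f x)"
proof -
  obtain u c where "\<forall>x. f x = u \<bullet> x + c" using assms by (auto simp: affine_fun_def)
  then show ?thesis unfolding affine_fun_def
    by (intro exI[of _ "a *\<^sub>R u"] exI[of _ "a * c"]) (simp add: algebra_simps)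
qed

lemma affine_fun_sum: "(\<And>s. s \<in> S \<Longrightarrow> affine_fun (f s)) \<Longrightarrow> affine_fun (\<lambda>x. \<Sum>s\<in>S. f s x)"
  by (induction S rule: infinite_finite_induct) (auto intro: affine_fun_const affine_fun_add)

lemma affine_fun_preact:
  "(\<And>j. affine_fun (\<lambda>x. h x j)) \<Longrightarrow> affine_fun (\<lambda>x. preact \<theta> d l i k (h x))"
  unfolding preact_def by (intro affine_fun_add affine_fun_sum affine_fun_mult affine_fun_const)

lemma affine_fun_input_coords: "affine_fun (\<lambda>x :: real^'n. input_coords x j)"
proof (cases "j < CARD('n)")
  case True
  then show ?thesis unfolding affine_fun_def
    by (intro exI[of _ "axis (inv_into UNIV (ix :: 'n \<Rightarrow> nat) j) 1"] exI[of _ 0])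
      (simp add: input_coords_def inner_axis' )
qed (simp add: input_coords_def affine_fun_const)

lemma affine_fun_selected_hidden:
  "affine_fun (\<lambda>x :: real^'n. selected_hidden \<theta> n0 ns Q l (input_coords x) i)"
proof (induction l arbitrary: i)
  case 0
  then show ?case by (simp add: affine_fun_input_coords)
next
  case (Suc l)
  then show ?case unfolding selected_hidden_Suc by (intro affine_fun_preact)
qed

lemma affine_fun_le_set:
  fixes f :: "'a::euclidean_space \<Rightarrow> real"
  assumes "affine_fun f" "affine_fun g"
  shows "convex {x. f x \<le> g x} \<and> closed {x. f x \<le> g x}"
proof -
  obtain u c v d where "\<forall>x. f x = u \<bullet> x + c" "\<forall>x. g x = v \<bullet> x + d" using assms by (auto simp: affine_fun_def)
  then have "{x. f x \<le> g x} = {x. (u - v) \<bullet> x \<le> d - c}" by (auto simp: inner_diff_left algebra_simps)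
  then show ?thesis by (simp add: convex_halfspace_le closed_halfspace_le)
qed

lemma convex_closed_selection_cell:
  "convex (selection_cell \<theta> ns K Q :: (real^'n) set)" "closed (selection_cell \<theta> ns K Q :: (real^'n) set)"
proof -
  have eq: "(selection_cell \<theta> ns K Q :: (real^'n) set) =
    (\<Inter>l\<in>{..<length ns}. \<Inter>i\<in>{..<width CARD('n) ns (Suc l)}. \<Inter>k\<in>{..<K}.
     {x. preact \<theta> (width CARD('n) ns l) (Suc l) i k (selected_hidden \<theta> CARD('n) ns Q l (input_coords x))
       \<le> selected_hidden \<theta> CARD('n) ns Q (Suc l) (input_coords x) i})"
    by (auto simp: selection_cell_def)
  have "convex {x :: real^'n. preact \<theta> (width CARD('n) ns l) (Suc l) i k (selected_hidden \<theta> CARD('n) ns Q l (input_coords x))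
       \<le> selected_hidden \<theta> CARD('n) ns Q (Suc l) (input_coords x) i} \<and>
     closed {x :: real^'n. preact \<theta> (width CARD('n) ns l) (Suc l) i k (selected_hidden \<theta> CARD('n) ns Q l (input_coords x))
       \<le> selected_hidden \<theta> CARD('n) ns Q (Suc l) (input_coords x) i}" for l i k
    by (intro affine_fun_le_set affine_fun_preact affine_fun_selected_hidden)
  then show "convex (selection_cell \<theta> ns K Q :: (real^'n) set)" "closed (selection_cell \<theta> ns K Q :: (real^'n) set)"
    unfolding eq by (auto intro!: convex_INT closed_INT simp del: selected_hidden.simps)
qed

text \<open>The linear part of the selected network, which is its derivative at every point. Written
  as a difference of two values, it inherits polynomial dependence on the parameters.\<close>

definition selected_slope ::
  "(nat \<times> nat \<times> nat \<times> nat \<Rightarrow> real) \<Rightarrow> nat list \<Rightarrow> (nat \<times> nat \<Rightarrow> nat) \<Rightarrow> real^'n \<Rightarrow> real^'m" where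
  "selected_slope \<theta> ns Q x = selected_net \<theta> ns Q x - selected_net \<theta> ns Q (0 :: real^'n)"

lemma linear_selected_slope: "linear (selected_slope \<theta> ns Q :: real^'n \<Rightarrow> real^'m)"
proof -
  have "\<forall>r. \<exists>g. \<forall>x. (selected_slope \<theta> ns Q :: real^'n \<Rightarrow> real^'m) x $ r = g \<bullet> x"
  proof
    fix r
    have "affine_fun (\<lambda>x. (selected_net \<theta> ns Q :: real^'n \<Rightarrow> real^'m) x $ r)"
      unfolding selected_net_def by (simp add: affine_fun_preact affine_fun_selected_hidden)
    then obtain g c where "\<forall>x. (selected_net \<theta> ns Q :: real^'n \<Rightarrow> real^'m) x $ r = g \<bullet> x + c"
      by (auto simp: affine_fun_def)
    then show "\<exists>g. \<forall>x. (selected_slope \<theta> ns Q :: real^'n \<Rightarrow> real^'m) x $ r = g \<bullet> x"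
      by (intro exI[of _ g]) (simp add: selected_slope_def)
  qed
  then obtain g where "\<And>r x. (selected_slope \<theta> ns Q :: real^'n \<Rightarrow> real^'m) x $ r = g r \<bullet> x" by metis
  then show ?thesis by (intro linearI) (simp_all add: vec_eq_iff inner_add_right)
qed

lemma has_derivative_selected_net:
  "((selected_net \<theta> ns Q :: real^'n \<Rightarrow> real^'m) has_derivative selected_slope \<theta> ns Q) (at x)"
proof -
  have "((\<lambda>x. selected_slope \<theta> ns Q x + selected_net \<theta> ns Q (0 :: real^'n) :: real^'m) has_derivative selected_slope \<theta> ns Q) (at x)"
    using linear_imp_has_derivative[OF linear_selected_slope] by (intro has_derivative_add_const) auto
  then show ?thesis by (simp add: selected_slope_def)
qed

section \<open>Dependence of the slopes on the parameters\<close>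

lemma poly_fun_selected_hidden:
  assumes Q: "Q \<in> selections n0 ns K" and "l \<le> length ns" "i < width n0 ns l"
  shows "poly_fun (maxout_params n0 ns K m) (\<lambda>\<theta>. selected_hidden \<theta> n0 ns Q l x i)"
  using assms(2,3)
proof (induction l arbitrary: i)
  case 0
  show ?case by (simp add: poly_fun_const)
next
  case (Suc l)
  have "Q (Suc l, i) < K" using Suc.prems by (intro selection_less[OF Q]) auto
  then show ?case unfolding selected_hidden.simps using Suc
    by (intro poly_fun_add poly_fun_sum poly_fun_mult poly_fun_component hidden_paramI) auto
qed

lemma poly_fun_selected_net:
  assumes Q: "Q \<in> selections CARD('n) ns K"
  shows "poly_fun (maxout_params CARD('n) ns K CARD('m))
    (\<lambda>\<theta>. (selected_net \<theta> ns Q (x :: real^'n) :: real^'m) $ r)"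
  unfolding selected_net_def preact_def vec_lambda_beta
  using poly_fun_selected_hidden[OF Q order_refl] ix_less[of r]
  by (intro poly_fun_add poly_fun_sum poly_fun_mult poly_fun_component output_paramI) auto

text \<open>A unit at which two selections differ lies on a path from the input to the output. Giving
  weight \<open>1\<close> to the edges of this path, but at that unit only for the piece chosen by the first
  selection, separates the two slopes.\<close>

lemma AE_selected_slopes_differ:
  assumes pos: "\<forall>n\<in>set ns. n > 0"
    and Q: "Q \<in> selections CARD('n) ns K" and Q': "Q' \<in> selections CARD('n) ns K" and neq: "Q \<noteq> Q'"
  shows "AE \<theta> in Pi\<^sub>M (maxout_params CARD('n) ns K CARD('m)) (\<lambda>_. lborel).
     (selected_slope \<theta> ns Q :: real^'n \<Rightarrow> real^'m) \<noteq> selected_slope \<theta> ns Q'"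
proof -
  let ?I = "maxout_params CARD('n) ns K CARD('m)"
  let ?n = "CARD('n)" and ?L = "length ns"
  define r :: 'm where "r = undefined"
  have "\<exists>l i. (l,i) \<in> {(l,i). 1 \<le> l \<and> l \<le> ?L \<and> i < width ?n ns l} \<and> Q (l,i) \<noteq> Q' (l,i)"
  proof (rule ccontr)
    assume "\<not> ?thesis"
    then have "Q = Q'" using Q Q' unfolding selections_def by (intro PiE_ext[of Q _ _ Q']) auto
    then show False using neq by simp
  qed
  then obtain l0 i0 where l0: "1 \<le> l0" "l0 \<le> ?L" "i0 < width ?n ns l0" "Q (l0,i0) \<noteq> Q' (l0,i0)" by auto
  define \<pi> where "\<pi> l = (if l = l0 then i0 else 0)" for l :: nat
  have width_pos: "0 < width ?n ns l" if "l \<le> ?L" for l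
    using that pos by (cases l) (auto simp: width_def)
  have \<pi>: "\<pi> l < width ?n ns l" if "l \<le> ?L" for l using width_pos[OF that] l0(3) by (simp add: \<pi>_def)
  \<comment> \<open>Every unit copies coordinate \<open>\<pi> (l - 1)\<close> of the previous layer,
    except that in layer \<open>l0\<close> only piece \<open>Q (l0,i0)\<close> does. Biases vanish
    because their index is the layer width, which \<open>\<pi>\<close> never reaches.\<close>
  define \<theta>\<^sub>0 :: "nat \<times> nat \<times> nat \<times> nat \<Rightarrow> real" where
    "\<theta>\<^sub>0 = restrict (\<lambda>(l,i,k,j). if j = \<pi> (l - 1) \<and> (l = l0 \<longrightarrow> k = Q (l0,i0)) then 1 else 0) ?I"
  have hidden0: "\<theta>\<^sub>0 (Suc l, i, k, j) = (if j = \<pi> l \<and> (Suc l = l0 \<longrightarrow> k = Q (l0,i0)) then 1 else 0)"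
    if "l < ?L" "i < width ?n ns (Suc l)" "k < K" "j \<le> width ?n ns l" for l i k j
    using hidden_paramI[OF that, of "CARD('m)"] by (simp add: \<theta>\<^sub>0_def)
  have output0: "\<theta>\<^sub>0 (Suc ?L, ix r, 0, j) = (if j = \<pi> ?L then 1 else 0)" if "j \<le> width ?n ns ?L" for j
    using output_paramI[OF ix_less that, of r K] l0(2) by (simp add: \<theta>\<^sub>0_def)
  have preact0: "preact \<theta>\<^sub>0 (width ?n ns l) (Suc l) i k h = (if Suc l = l0 \<longrightarrow> k = Q (l0,i0) then h (\<pi> l) else 0)"
    if l: "l < ?L" "i < width ?n ns (Suc l)" "k < K" for l i k h
  proof -
    have "preact \<theta>\<^sub>0 (width ?n ns l) (Suc l) i k h =
        (\<Sum>j<width ?n ns l. if j = \<pi> l then (if Suc l = l0 \<longrightarrow> k = Q (l0,i0) then h (\<pi> l) else 0) else 0)"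
    proof -
      have "(\<Sum>j<width ?n ns l. \<theta>\<^sub>0 (Suc l, i, k, j) * h j) = (\<Sum>j<width ?n ns l.
          if j = \<pi> l then (if Suc l = l0 \<longrightarrow> k = Q (l0,i0) then h (\<pi> l) else 0) else 0)"
        by (rule sum.cong) (auto simp: hidden0[OF l])
      moreover have "\<theta>\<^sub>0 (Suc l, i, k, width ?n ns l) = 0"
        using hidden0[OF l, of "width ?n ns l"] \<pi>[of l] l by simp
      ultimately show ?thesis by (simp add: preact_def)
    qed
    then show ?thesis using \<pi>[of l] l by simp
  qed
  have net0: "(selected_net \<theta>\<^sub>0 ns P x :: real^'m) $ r = selected_hidden \<theta>\<^sub>0 ?n ns P ?L (input_coords x) (\<pi> ?L)"
    for P and x :: "real^'n"
  proof -
    have "(selected_net \<theta>\<^sub>0 ns P x :: real^'m) $ r =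
        (\<Sum>j<width ?n ns ?L. if j = \<pi> ?L then selected_hidden \<theta>\<^sub>0 ?n ns P ?L (input_coords x) (\<pi> ?L) else 0)"
    proof -
      have "(\<Sum>j<width ?n ns ?L. \<theta>\<^sub>0 (Suc ?L, ix r, 0, j) * selected_hidden \<theta>\<^sub>0 ?n ns P ?L (input_coords x) j) =
          (\<Sum>j<width ?n ns ?L. if j = \<pi> ?L then selected_hidden \<theta>\<^sub>0 ?n ns P ?L (input_coords x) (\<pi> ?L) else 0)"
        by (rule sum.cong) (auto simp: output0)
      moreover have "\<theta>\<^sub>0 (Suc ?L, ix r, 0, width ?n ns ?L) = 0"
        using output0[of "width ?n ns ?L"] \<pi>[of ?L] by simp
      ultimately show ?thesis by (simp add: selected_net_def preact_def)
    qed
    then show ?thesis using \<pi>[of ?L] by simp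
  qed
  have on_path: "selected_hidden \<theta>\<^sub>0 ?n ns Q l x (\<pi> l) = x 0" if "l \<le> ?L" for l x
    using that
  proof (induction l)
    case 0
    show ?case using l0(1) by (simp add: \<pi>_def)
  next
    case (Suc l)
    have "l < ?L" "\<pi> (Suc l) < width ?n ns (Suc l)" using Suc.prems \<pi> by auto
    then have "preact \<theta>\<^sub>0 (width ?n ns l) (Suc l) (\<pi> (Suc l)) (Q (Suc l, \<pi> (Suc l))) (selected_hidden \<theta>\<^sub>0 ?n ns Q l x)
        = selected_hidden \<theta>\<^sub>0 ?n ns Q l x (\<pi> l)"
      using selection_less[OF Q] by (subst preact0) (auto simp: \<pi>_def)
    then show ?case using Suc by (simp only: selected_hidden_Suc)
  qed
  \<comment> \<open>In layer \<open>l0\<close> the piece taken by \<open>Q'\<close> is zero at the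
    path, and later layers copy this zero.\<close>
  have off_path: "selected_hidden \<theta>\<^sub>0 ?n ns Q' l x (\<pi> l) = 0" if "l0 \<le> l" "l \<le> ?L" for l x
    using that
  proof (induction l rule: dec_induct)
    case base
    obtain l' where l': "l0 = Suc l'" using l0(1) by (cases l0) auto
    have "l' < ?L" "i0 < width ?n ns (Suc l')" using l0 l' by auto
    then have "preact \<theta>\<^sub>0 (width ?n ns l') (Suc l') i0 (Q' (Suc l', i0)) (selected_hidden \<theta>\<^sub>0 ?n ns Q' l' x) = 0"
      using selection_less[OF Q'] l0(4) l' by (subst preact0) auto
    then have "selected_hidden \<theta>\<^sub>0 ?n ns Q' (Suc l') x i0 = 0" by (simp only: selected_hidden_Suc)
    then show ?case using l' by (simp only: \<pi>_def) simp
  next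
    case (step l)
    have "l < ?L" "\<pi> (Suc l) < width ?n ns (Suc l)" using step.prems \<pi> by auto
    then have "preact \<theta>\<^sub>0 (width ?n ns l) (Suc l) (\<pi> (Suc l)) (Q' (Suc l, \<pi> (Suc l))) (selected_hidden \<theta>\<^sub>0 ?n ns Q' l x)
        = selected_hidden \<theta>\<^sub>0 ?n ns Q' l x (\<pi> l)"
      using selection_less[OF Q'] step.hyps by (subst preact0) auto
    then show ?case using step by (simp only: selected_hidden_Suc)
  qed
  define j0 :: 'n where "j0 = inv_into UNIV ix 0"
  let ?e = "axis j0 1 :: real^'n"
  define D where "D \<theta> = ((selected_net \<theta> ns Q ?e :: real^'m) $ r - (selected_net \<theta> ns Q (0 :: real^'n) :: real^'m) $ r)
     - ((selected_net \<theta> ns Q' ?e :: real^'m) $ r - (selected_net \<theta> ns Q' (0 :: real^'n) :: real^'m) $ r)" for \<theta>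
  \<comment> \<open>The vector \<open>?e\<close> has 1 at the coordinate numbered 0, where the path
    starts; \<open>Q\<close> carries this 1 to the output and \<open>Q'\<close> carries 0.\<close>
  have "D \<theta>\<^sub>0 = 1"
    using l0(2) by (simp add: D_def net0 on_path off_path input_coords_def j0_def)
  then have "D \<theta>\<^sub>0 \<noteq> 0" by simp
  moreover have "poly_fun ?I D"
    unfolding D_def by (intro poly_fun_diff poly_fun_selected_net Q Q')
  moreover have "\<theta>\<^sub>0 \<in> extensional ?I" by (simp add: \<theta>\<^sub>0_def)
  ultimately have "AE \<theta> in Pi\<^sub>M ?I (\<lambda>_. lborel). D \<theta> \<noteq> 0"
    by (intro AE_poly_fun_nonzero finite_maxout_params)
  then show ?thesis
  proof (rule eventually_mono)
    fix \<theta> assume "D \<theta> \<noteq> 0"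
    then have "(selected_slope \<theta> ns Q ?e :: real^'m) $ r \<noteq> (selected_slope \<theta> ns Q' ?e :: real^'m) $ r"
      by (simp add: D_def selected_slope_def)
    then show "(selected_slope \<theta> ns Q :: real^'n \<Rightarrow> real^'m) \<noteq> selected_slope \<theta> ns Q'" by metis
  qed
qed

text \<open>The point \<open>y\<close> may lie on the boundary of \<open>C\<close>, so
  \<open>f\<close> and \<open>g\<close> need not agree near it. One-sided derivatives along segments
  into \<open>C\<close> still agree, and these directions span the space because \<open>C\<close>
  has interior.\<close>

lemma has_derivative_eq_on_convex:
  fixes f g :: "'a::euclidean_space \<Rightarrow> 'b::real_normed_vector"
  assumes C: "convex C" "interior C \<noteq> {}" "y \<in> C" and eq: "\<And>x. x \<in> C \<Longrightarrow> f x = g x"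
    and f: "(f has_derivative A) (at y)" and g: "(g has_derivative B) (at y)"
  shows "A = B"
proof -
  have lin: "linear A" "linear B" using f g has_derivative_linear by blast+
  have agree: "A (x - y) = B (x - y)" if x: "x \<in> C" for x
  proof -
    let ?p = "\<lambda>t::real. y + t *\<^sub>R (x - y)"
    have p: "(?p has_derivative (\<lambda>t. t *\<^sub>R (x - y))) (at 0 within {0..1})"
      by (auto intro!: derivative_eq_intros)
    have "((\<lambda>t. f (?p t)) has_derivative (\<lambda>t. A (t *\<^sub>R (x - y)))) (at 0 within {0..1})"
      by (rule has_derivative_compose[OF p]) (use f in simp)
    moreover have "((\<lambda>t. f (?p t)) has_derivative (\<lambda>t. B (t *\<^sub>R (x - y)))) (at 0 within {0..1})"
    proof (rule has_derivative_transform)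
      show "((\<lambda>t. g (?p t)) has_derivative (\<lambda>t. B (t *\<^sub>R (x - y)))) (at 0 within {0..1})"
        by (rule has_derivative_compose[OF p]) (use g in simp)
      fix t :: real assume "t \<in> {0..1}"
      then have "(1 - t) *\<^sub>R y + t *\<^sub>R x \<in> C" using C x by (intro convexD) auto
      then have "?p t \<in> C" by (simp add: algebra_simps)
      then show "f (?p t) = g (?p t)" by (rule eq)
    qed simp
    ultimately have "(\<lambda>t. A (t *\<^sub>R (x - y))) = (\<lambda>t. B (t *\<^sub>R (x - y)))"
      by (intro frechet_derivative_unique_within_closed_interval[of 0 1 "0::real"]) auto
    then show ?thesis by (metis scaleR_one)
  qed
  obtain z where "z \<in> interior C" using C by auto
  then obtain e where e: "e > 0" "ball z e \<subseteq> C" by (meson mem_interior)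
  show ?thesis
  proof
    fix v :: 'a
    \<comment> \<open>Small enough to keep \<open>z + t *\<^sub>R v\<close> in the ball; the
      \<open>+ 1\<close> covers \<open>v = 0\<close>.\<close>
    define t where "t = e / (2 * (norm v + 1))"
    have t: "t > 0" using e by (simp add: t_def add_nonneg_pos)
    have "t * norm v < e"
    proof -
      have "t * norm v \<le> t * (norm v + 1)" using t by simp
      also have "\<dots> = e / 2" by (simp add: t_def field_simps add_nonneg_eq_0_iff)
      finally show ?thesis using e by simp
    qed
    then have "z + t *\<^sub>R v \<in> C" using e t by (auto simp: subset_iff dist_norm)
    moreover have "z \<in> C" using e by auto
    ultimately have "A (z + t *\<^sub>R v - y) - A (z - y) = B (z + t *\<^sub>R v - y) - B (z - y)" using agree by simp
    then have "A (t *\<^sub>R v) = B (t *\<^sub>R v)"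
      by (simp add: linear_diff[OF lin(1), symmetric] linear_diff[OF lin(2), symmetric])
    then show "A v = B v" using t lin by (simp add: linear_scale)
  qed
qed

text \<open>A convex cell without interior is negligible. Any other cell is the closure of its
  interior, so it misses \<open>U\<close> if its interior does. If no interior met \<open>U\<close>,
  finitely many negligible sets would cover \<open>U\<close>.\<close>

lemma fat_selection_cell_exists:
  fixes U :: "(real^'n) set"
  assumes K: "0 < K" and U: "open U" "U \<noteq> {}"
  shows "\<exists>Q\<in>selections CARD('n) ns K. interior (selection_cell \<theta> ns K Q) \<inter> U \<noteq> {}"
proof (rule ccontr)
  assume thin: "\<not> ?thesis"
  have "negligible (selection_cell \<theta> ns K Q \<inter> U)" if Q: "Q \<in> selections CARD('n) ns K" for Q
  proof (cases "interior (selection_cell \<theta> ns K Q :: (real^'n) set) = {}")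
    case True
    then have "negligible (selection_cell \<theta> ns K Q :: (real^'n) set)"
      using negligible_convex_interior[OF convex_closed_selection_cell(1)] by blast
    then show ?thesis by (rule negligible_subset) auto
  next
    case False
    then have "selection_cell \<theta> ns K Q = closure (interior (selection_cell \<theta> ns K Q :: (real^'n) set))"
      using convex_closed_selection_cell by (metis closure_closed convex_closure_interior)
    then have "selection_cell \<theta> ns K Q \<inter> U = {}"
      using thin Q U(1) by (metis open_Int_closure_eq_empty Int_commute)
    then show ?thesis by simp
  qed
  then have "negligible (\<Union>Q\<in>selections CARD('n) ns K. selection_cell \<theta> ns K Q \<inter> U)"
    by (intro negligible_Union) (auto simp: finite_selections)
  moreover have "U \<subseteq> (\<Union>Q\<in>selections CARD('n) ns K. selection_cell \<theta> ns K Q \<inter> U)"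
    using selection_cells_cover[OF K] by blast
  ultimately have "negligible U" by (rule negligible_subset)
  then show False using open_not_negligible U by blast
qed

text \<open>The cells with interior are closed and finite in number, so a point outside all of them
  would have an open neighbourhood outside them, contrary to the preceding lemma.\<close>

lemma fat_selection_cells_cover:
  fixes x :: "real^'n"
  assumes K: "0 < K"
  shows "\<exists>Q\<in>selections CARD('n) ns K. interior (selection_cell \<theta> ns K Q :: (real^'n) set) \<noteq> {} \<and> x \<in> selection_cell \<theta> ns K Q"
proof (rule ccontr)
  assume no: "\<not> ?thesis"
  let ?fat = "{Q \<in> selections CARD('n) ns K. interior (selection_cell \<theta> ns K Q :: (real^'n) set) \<noteq> {}}"
  let ?U = "- (\<Union>Q\<in>?fat. selection_cell \<theta> ns K Q :: (real^'n) set)"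
  have "open ?U" using convex_closed_selection_cell(2) finite_selections by (intro open_Compl closed_UN) auto
  moreover have "x \<in> ?U" using no by auto
  ultimately obtain Q where "Q \<in> selections CARD('n) ns K" "interior (selection_cell \<theta> ns K Q) \<inter> ?U \<noteq> {}"
    using fat_selection_cell_exists[OF K, of ?U ns \<theta>] by blast
  then show False using interior_subset by blast
qed

text \<open>Some cell with interior contains \<open>y\<close>, possibly on its boundary; there the
  derivative equals that cell's slope, and distinct slopes identify the selection. This confines a
  linear region to one cell.\<close>

lemma has_derivative_selected_slope_imp_cell:
  fixes y :: "real^'n"
  assumes K: "0 < K" and Q: "Q \<in> selections CARD('n) ns K"
    and inj: "inj_on (\<lambda>Q. selected_slope \<theta> ns Q :: real^'n \<Rightarrow> real^'m) (selections CARD('n) ns K)"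
    and deriv: "((maxout_net \<theta> ns K :: real^'n \<Rightarrow> real^'m) has_derivative selected_slope \<theta> ns Q) (at y)"
  shows "y \<in> selection_cell \<theta> ns K Q"
proof -
  obtain Q' where Q': "Q' \<in> selections CARD('n) ns K" "interior (selection_cell \<theta> ns K Q' :: (real^'n) set) \<noteq> {}"
      "y \<in> selection_cell \<theta> ns K Q'"
    using fat_selection_cells_cover[OF K] by blast
  have "(selected_slope \<theta> ns Q :: real^'n \<Rightarrow> real^'m) = selected_slope \<theta> ns Q'"
    using net_eq_selected[OF Q'(1)]
    by (intro has_derivative_eq_on_convex[OF convex_closed_selection_cell(1) Q'(2,3) _ deriv has_derivative_selected_net]) auto
  then have "Q = Q'" using inj Q Q'(1) by (auto dest: inj_onD)
  then show ?thesis using Q' by simp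
qed

section \<open>Linear regions for generic parameters\<close>

lemma preact_first_layer:
  "preact \<theta> CARD('n) (Suc 0) i k (input_coords (x :: real^'n)) = first_weight \<theta> i k \<bullet> x + first_bias CARD('n) \<theta> i k"
proof -
  have "(\<Sum>j<CARD('n). \<theta> (Suc 0,i,k,j) * input_coords x j) = (\<Sum>j\<in>UNIV. \<theta> (Suc 0,i,k,ix j) * input_coords x (ix (j :: 'n)))"
    by (rule sum.reindex_bij_betw[OF bij_betw_ix, symmetric])
  also have "\<dots> = first_weight \<theta> i k \<bullet> x"
    by (simp add: input_coords_def ix_less inj_ix first_weight_def inner_vec_def)
  finally show ?thesis by (simp add: preact_def first_bias_def)
qed

text \<open>Each pattern owns the region of a point interior to a selection cell that meets its open
  cell. The bounds go through finite subsets \<open>S\<close> because \<open>card\<close> is 0 on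
  infinite sets.\<close>

lemma linear_regions_of_generic_params:
  fixes \<theta> :: "nat \<times> nat \<times> nat \<times> nat \<Rightarrow> real"
  assumes ns: "ns \<noteq> []"
    and gen: "generic_arrangement (first_weight \<theta> :: nat \<Rightarrow> nat \<Rightarrow> real^'n) (first_bias CARD('n) \<theta>) (hd ns) K"
    and inj: "inj_on (\<lambda>Q. selected_slope \<theta> ns Q :: real^'n \<Rightarrow> real^'m) (selections CARD('n) ns K)"
  shows "(\<exists>S \<subseteq> linear_regions (maxout_net \<theta> ns K :: real^'n \<Rightarrow> real^'m).
         finite S \<and> (\<Sum>j\<le>CARD('n). hd ns choose j) \<le> card S)
   \<and> (\<exists>S \<subseteq> linear_regions (maxout_net \<theta> ns K :: real^'n \<Rightarrow> real^'m).
         finite S \<and> (\<forall>R\<in>S. bounded R) \<and> (hd ns - 1) choose CARD('n) \<le> card S)"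
proof -
  interpret generic_arrangement "first_weight \<theta> :: nat \<Rightarrow> nat \<Rightarrow> real^'n" "first_bias CARD('n) \<theta>" "hd ns" K
    by (rule gen)
  let ?f = "maxout_net \<theta> ns K :: real^'n \<Rightarrow> real^'m"
  let ?D = "\<lambda>Q. {x. (?f has_derivative selected_slope \<theta> ns Q) (at x)}"
  have K0: "0 < K" using K_ge_2 by simp
  have L: "0 < length ns" using ns by simp
  have w1: "width CARD('n) ns (Suc 0) = hd ns" using ns by (simp add: width_def hd_conv_nth)
  have cell_active: "Q (1,i) \<in> active i x"
    if Q: "Q \<in> selections CARD('n) ns K" and x: "x \<in> selection_cell \<theta> ns K Q" and i: "i < hd ns"
    for Q i and x :: "real^'n"
  proof -
    have "piece i k x = preact \<theta> (width CARD('n) ns 0) (Suc 0) i k (selected_hidden \<theta> CARD('n) ns Q 0 (input_coords x))" for k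
      by (simp add: piece_def width_def preact_first_layer)
    moreover have "Q (Suc 0, i) < K" using selection_less[OF Q L] i w1 by simp
    moreover have "preact \<theta> (width CARD('n) ns 0) (Suc 0) i k (selected_hidden \<theta> CARD('n) ns Q 0 (input_coords x))
        \<le> preact \<theta> (width CARD('n) ns 0) (Suc 0) i (Q (Suc 0, i)) (selected_hidden \<theta> CARD('n) ns Q 0 (input_coords x))"
      if "k < K" for k
      using x L i w1 that by (simp only: selection_cell_def mem_Collect_eq selected_hidden_Suc)
    ultimately show ?thesis by (simp add: active_def)
  qed
  have "\<exists>Q x. Q \<in> selections CARD('n) ns K \<and> x \<in> ?D Q \<and> (\<forall>i<hd ns. Q (1,i) = p i)" if p: "p \<in> patterns" for p
  proof -
    have "open (open_cell p)" using p by (intro open_open_cell) (auto simp: patterns_def)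
    moreover have "open_cell p \<noteq> {}" using p by (simp add: patterns_def)
    ultimately obtain Q x where Q: "Q \<in> selections CARD('n) ns K"
      and x: "x \<in> interior (selection_cell \<theta> ns K Q)" "x \<in> open_cell p"
      using fat_selection_cell_exists[OF K0] by blast
    have "(?f has_derivative selected_slope \<theta> ns Q) (at x)"
      using has_derivative_selected_net open_interior x(1)
      by (rule has_derivative_transform_within_open) (use net_eq_selected[OF Q] interior_subset in \<open>metis subsetD\<close>)
    moreover have "Q (1,i) = p i" if i: "i < hd ns" for i
    proof -
      have "Q (1,i) \<in> active i x" using x(1) interior_subset by (intro cell_active[OF Q _ i]) blast
      then show ?thesis using x(2) i by (auto simp: open_cell_def)
    qed
    ultimately show ?thesis using Q by blast
  qed
  then obtain Q X where QX: "\<And>p. p \<in> patterns \<Longrightarrow> Q p \<in> selections CARD('n) ns K \<and> X p \<in> ?D (Q p) \<and> (\<forall>i<hd ns. Q p (1,i) = p i)"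
    by metis
  define R where "R p = connected_component_set (?D (Q p)) (X p)" for p
  have R_sub: "R p \<subseteq> ?D (Q p)" for p unfolding R_def by (rule connected_component_subset)
  have X_R: "X p \<in> R p" if "p \<in> patterns" for p
    using QX[OF that] by (simp add: R_def connected_component_refl)
  have R_reg: "R p \<in> linear_regions ?f" if "p \<in> patterns" for p
  proof -
    have "R p \<in> components (?D (Q p))" unfolding R_def using QX[OF that] by (intro componentsI) blast
    then show ?thesis unfolding linear_regions_def by blast
  qed
  have inj_R: "inj_on R patterns"
  proof (rule inj_onI)
    fix p p' assume p: "p \<in> patterns" "p' \<in> patterns" and eq: "R p = R p'"
    \<comment> \<open>Equal regions share the point \<open>X p\<close>; its derivative is unique, so
      the selections agree, and with them the first-layer patterns.\<close>
    have "X p \<in> ?D (Q p)" "X p \<in> ?D (Q p')" using X_R[OF p(1)] eq R_sub by blast+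
    then have "(selected_slope \<theta> ns (Q p) :: real^'n \<Rightarrow> real^'m) = selected_slope \<theta> ns (Q p')"
      using has_derivative_unique by blast
    then have "Q p = Q p'" using inj QX[OF p(1)] QX[OF p(2)] by (auto dest: inj_onD)
    then have "p i = p' i" if "i < hd ns" for i using QX[OF p(1)] QX[OF p(2)] that by metis
    then show "p = p'" using p by (intro PiE_ext[of p "{..<hd ns}" "\<lambda>_. {..<K}" p']) (auto simp: patterns_def)
  qed
  have R_bounded: "bounded (R p)" if p: "p \<in> patterns" and bd: "bounded (closed_cell p)" for p
  proof (rule bounded_subset[OF bd], rule subsetI)
    fix y assume "y \<in> R p"
    then have "(?f has_derivative selected_slope \<theta> ns (Q p)) (at y)" using R_sub by blast
    then have "y \<in> selection_cell \<theta> ns K (Q p)"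
      using QX[OF p] by (intro has_derivative_selected_slope_imp_cell[OF K0 _ inj]) auto
    then have "Q p (1,i) \<in> active i y" if "i < hd ns" for i
      using QX[OF p] that by (intro cell_active) auto
    then show "y \<in> closed_cell p" using QX[OF p] by (simp add: closed_cell_def)
  qed
  have card_R: "card (R ` P) = card P" if "P \<subseteq> patterns" for P
    using inj_on_subset[OF inj_R that] by (rule card_image)
  show ?thesis
  proof (intro conjI)
    show "\<exists>S \<subseteq> linear_regions ?f. finite S \<and> (\<Sum>j\<le>CARD('n). hd ns choose j) \<le> card S"
      using R_reg finite_patterns card_patterns_ge card_R[OF order_refl]
      by (intro exI[of _ "R ` patterns"]) auto
    show "\<exists>S \<subseteq> linear_regions ?f. finite S \<and> (\<forall>R\<in>S. bounded R) \<and> (hd ns - 1) choose CARD('n) \<le> card S"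
      using R_reg R_bounded finite_patterns card_bounded_patterns_ge card_R[of "{p \<in> patterns. bounded (closed_cell p)}"]
      by (intro exI[of _ "R ` {p \<in> patterns. bounded (closed_cell p)}"]) auto
  qed
qed

theorem theorem2:
  fixes ns :: "nat list" and K :: nat
  assumes "K \<ge> 2" and "ns \<noteq> []" and "\<forall>n\<in>set ns. n > 0"
  shows "AE \<theta> in Pi\<^sub>M (maxout_params CARD('n) ns K CARD('m)) (\<lambda>_. lborel).
     (\<exists>S \<subseteq> linear_regions (maxout_net \<theta> ns K :: real^'n \<Rightarrow> real^'m).
         finite S \<and> (\<Sum>j\<le>CARD('n). hd ns choose j) \<le> card S)
   \<and> (\<exists>S \<subseteq> linear_regions (maxout_net \<theta> ns K :: real^'n \<Rightarrow> real^'m).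
         finite S \<and> (\<forall>R\<in>S. bounded R) \<and> (hd ns - 1) choose CARD('n) \<le> card S)"
proof -
  let ?M = "Pi\<^sub>M (maxout_params CARD('n) ns K CARD('m)) (\<lambda>_. lborel :: real measure)"
  let ?S = "selections CARD('n) ns K"
  have "AE \<theta> in ?M. (selected_slope \<theta> ns Q :: real^'n \<Rightarrow> real^'m) \<noteq> selected_slope \<theta> ns Q'"
    if "Q \<in> ?S" "Q' \<in> ?S" "Q \<noteq> Q'" for Q Q'
    using AE_selected_slopes_differ[OF assms(3) that] .
  \<comment> \<open>Finitely many pairs of selections, so finitely many null sets are
    discarded.\<close>
  then have "AE \<theta> in ?M. \<forall>Q\<in>?S. \<forall>Q'\<in>?S. Q \<noteq> Q' \<longrightarrow>
      (selected_slope \<theta> ns Q :: real^'n \<Rightarrow> real^'m) \<noteq> selected_slope \<theta> ns Q'"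
    by (simp add: AE_ball_countable countable_finite finite_selections)
  with AE_generic_arrangement[OF assms(1,2)] show ?thesis
  proof eventually_elim
    case (elim \<theta>)
    then have "inj_on (\<lambda>Q. selected_slope \<theta> ns Q :: real^'n \<Rightarrow> real^'m) ?S" by (auto simp: inj_on_def)
    then show ?case using elim by (intro linear_regions_of_generic_params assms(2)) auto
  qed
qed

end
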